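(* Let $X,Y$ be two non-atomic (standard) probability spaces and $(D,e)$ a pointed discrete metric space. There exists a morphism (1-Lipschitz map of pseudo-metric spaces) $\mathcal{L}(X\times Y,D)\to\mathcal{L}(X,\mathcal{L}(Y,D))$ inducing a bijective isometry $L(X\times Y,D)\to L(X,L(Y,D))$. This isometry is equivariant with respect to the obvious actions of the group $\mathfrak{S}(D)$ of permutations of $D$.
   Context: $X$ and $Y$ are copies of $\Omega$, an uncountable standard Borel space endowed with a non-atomic probability measure; $X\times Y$ has the product measure. A discrete metric space is a set $D$ (of any cardinality) with $d(x,y)=1$ for $x\neq y$ and $d(x,x)=0$. For a probability space $Z$ and a (pseudo-)metric space $E$, $\mathcal{L}(Z,E)$ is the set of Borel maps $f:Z\to E$ such that $\int_Z d(f(z),c)\,dz<\infty$ for one (equivalently every) $c\in E$, with the pseudo-distance $d(f,g)=\int_Z d(f(z),g(z))\,dz$, and $L(Z,E)$ is the associated metric space (identifying points at distance $0$). Borel sets of the pseudo-metric space $\mathcal{L}(Y,D)$ are those generated by the topology of its pseudo-distance. $\mathfrak{S}(D)$ acts by post-composition on the values in $D$. *)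

theory Defs
  imports "HOL-Probability.Probability" "HOL-Combinatorics.Permutations"
begin

section \<open>Standard non-atomic probability spaces\<close>

text \<open>A standard Borel space: the measurable sets are the Borel sets of some Polish topology.\<close>

definition standard_borel_space :: "'a measure \<Rightarrow> bool" where
  "standard_borel_space M \<longleftrightarrow>
     (\<exists>T. completely_metrizable_space T \<and> second_countable T \<and>
          topspace T = space M \<and> sets M = sigma_sets (space M) {U. openin T U})"

definition nonatomic :: "'a measure \<Rightarrow> bool" where
  "nonatomic M \<longleftrightarrow>
     (\<forall>A\<in>sets M. 0 < emeasure M A \<longrightarrow>
        (\<exists>B\<in>sets M. B \<subseteq> A \<and> 0 < emeasure M B \<and> emeasure M B < emeasure M A))"

definition nonatomic_standard_prob_space :: "'a measure \<Rightarrow> bool" where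
  "nonatomic_standard_prob_space M \<longleftrightarrow>
     prob_space M \<and> standard_borel_space M \<and> uncountable (space M) \<and> nonatomic M"


section \<open>Pseudo-metric spaces\<close>

text \<open>The library types and locales cover only genuine metric spaces. Here the underlying
  data are kept apart from the axioms, so that spaces of maps can be nested.\<close>

record 'a pms =
  pts :: "'a set"
  pdist :: "'a \<Rightarrow> 'a \<Rightarrow> real"

definition pseudo_metric_space :: "'a pms \<Rightarrow> bool" where
  "pseudo_metric_space E \<longleftrightarrow>
     (\<forall>x\<in>pts E. pdist E x x = 0) \<and>
     (\<forall>x\<in>pts E. \<forall>y\<in>pts E. 0 \<le> pdist E x y \<and> pdist E x y = pdist E y x) \<and>
     (\<forall>x\<in>pts E. \<forall>y\<in>pts E. \<forall>z\<in>pts E. pdist E x z \<le> pdist E x y + pdist E y z)"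

definition discrete_pms :: "'a set \<Rightarrow> 'a pms" where
  "discrete_pms D = \<lparr>pts = D, pdist = discrete_metric.dd\<rparr>"

definition pms_open :: "'a pms \<Rightarrow> 'a set \<Rightarrow> bool" where
  "pms_open E U \<longleftrightarrow>
     U \<subseteq> pts E \<and> (\<forall>x\<in>U. \<exists>r>0. \<forall>y\<in>pts E. pdist E x y < r \<longrightarrow> y \<in> U)"

definition pms_borel :: "'a pms \<Rightarrow> 'a measure" where
  "pms_borel E = sigma (pts E) {U. pms_open E U}"

text \<open>Morphisms of pseudo-metric spaces are the 1-Lipschitz maps.\<close>

definition pms_morphism :: "'a pms \<Rightarrow> 'b pms \<Rightarrow> ('a \<Rightarrow> 'b) \<Rightarrow> bool" where
  "pms_morphism E F \<phi> \<longleftrightarrow>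
     pseudo_metric_space E \<and> pseudo_metric_space F \<and> \<phi> \<in> pts E \<rightarrow> pts F \<and>
     (\<forall>x\<in>pts E. \<forall>y\<in>pts E. pdist F (\<phi> x) (\<phi> y) \<le> pdist E x y)"

definition bijective_isometry :: "'a pms \<Rightarrow> 'b pms \<Rightarrow> ('a \<Rightarrow> 'b) \<Rightarrow> bool" where
  "bijective_isometry E F \<phi> \<longleftrightarrow>
     bij_betw \<phi> (pts E) (pts F) \<and>
     (\<forall>x\<in>pts E. \<forall>y\<in>pts E. pdist F (\<phi> x) (\<phi> y) = pdist E x y)"


section \<open>The associated metric space\<close>

definition zero_rel :: "'a pms \<Rightarrow> ('a \<times> 'a) set" where
  "zero_rel E = {(x, y). x \<in> pts E \<and> y \<in> pts E \<and> pdist E x y = 0}"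

definition pms_class :: "'a pms \<Rightarrow> 'a \<Rightarrow> 'a set" where
  "pms_class E x = zero_rel E `` {x}"

definition metric_quotient :: "'a pms \<Rightarrow> 'a set pms" where
  "metric_quotient E =
     \<lparr>pts = pts E // zero_rel E,
      pdist = (\<lambda>A B. THE r. \<forall>x\<in>A. \<forall>y\<in>B. pdist E x y = r)\<rparr>"

text \<open>The self-map of the associated metric space induced by a self-map of a pseudo-metric
  space; it sends the class of \<open>x\<close> to the class of \<open>\<tau> x\<close> whenever \<open>\<tau>\<close> preserves distance zero.\<close>

definition quotient_map_of :: "'a pms \<Rightarrow> ('a \<Rightarrow> 'a) \<Rightarrow> 'a set \<Rightarrow> 'a set" where
  "quotient_map_of E \<tau> C = (\<Union>x\<in>C. pms_class E (\<tau> x))"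


section \<open>Spaces of integrable maps\<close>

text \<open>Maps out of \<open>Z\<close> are represented by functions that are \<open>undefined\<close> outside \<open>space Z\<close>.
  No separability of \<open>E\<close> is assumed, so measurability of \<open>z \<mapsto> d (f z) (g z)\<close> is not evident.
  It does hold for Borel \<open>f\<close> and \<open>g\<close> on a standard Borel space \<open>Z\<close>, since their ranges are
  separable; the distance is written with the nonnegative integral, which is invariant under
  almost everywhere equality without measurability assumptions. On the points of \<open>calL Z E\<close> this
  integral is finite.\<close>

definition calL :: "'z measure \<Rightarrow> 'a pms \<Rightarrow> ('z \<Rightarrow> 'a) pms" where
  "calL Z E =
     \<lparr>pts = {f. f \<in> measurable Z (pms_borel E) \<and> f \<in> extensional (space Z) \<and>
               (\<exists>c\<in>pts E. (\<integral>\<^sup>+ z. ennreal (pdist E (f z) c) \<partial>Z) < \<infinity>)},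
      pdist = (\<lambda>f g. enn2real (\<integral>\<^sup>+ z. ennreal (pdist E (f z) (g z)) \<partial>Z))\<rparr>"

definition metL :: "'z measure \<Rightarrow> 'a pms \<Rightarrow> ('z \<Rightarrow> 'a) set pms" where
  "metL Z E = metric_quotient (calL Z E)"

text \<open>The action on classes of maps \<open>Z \<rightarrow> E\<close> of a self-map \<open>\<tau>\<close> of \<open>E\<close>, by post-composition.\<close>

definition metL_act :: "'z measure \<Rightarrow> 'a pms \<Rightarrow> ('a \<Rightarrow> 'a) \<Rightarrow> ('z \<Rightarrow> 'a) set \<Rightarrow> ('z \<Rightarrow> 'a) set" where
  "metL_act Z E \<tau> = quotient_map_of (calL Z E) (\<lambda>f. \<lambda>z\<in>space Z. \<tau> (f z))"

end

theory Submission
  imports Defs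
begin

text \<open>
  The isometry is currying, \<open>f \<mapsto> (x \<mapsto> f (x, \<cdot>))\<close>. On a discrete space \<open>d (f, g)\<close> is the measure of
  \<open>{f \<noteq> g}\<close>, so that Fubini's theorem gives the isometry and pointwise reasoning gives the
  equivariance. The substance of the proof is that all this makes sense and is onto although
  \<open>D\<close> may be uncountable, so that neither \<open>D\<close> nor the space of maps \<open>Y \<rightarrow> D\<close> is separable.

  The key is \<open>ae_countable_range\<close>: a map \<open>f\<close> from a standard probability space to \<open>D\<close>, all of whose
  preimages are measurable, takes countably many values almost everywhere. Otherwise, after removing
  the countably many fibres of positive measure, all fibres are null. Choosing a point in each fibre
  makes \<open>f\<close> real valued, and composing with its own distribution function makes it uniformly
  distributed on the unit interval. So a map \<open>h\<close> with uniform distribution would have only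
  measurable preimages. Cover the line by the countably many rational translates of a Vitali set. A
  compact subset of such a translate is Lebesgue null, hence its preimage is null. Measures on
  standard spaces are perfect: the measure of \<open>h -` V\<close> is the supremum over compact \<open>K \<subseteq> V\<close> of the measure
  of \<open>h -` K\<close>. So the whole space would be null.

  For a Borel map \<open>F\<close> into any pseudo-metric space \<open>E\<close> it follows that almost all values of \<open>F\<close> lie
  in a separable set (\<open>ae_separable_range\<close>). Indeed, well-order the \<open>\<epsilon>\<close>-balls of \<open>E\<close> and send a point
  to the centre of the first ball that contains it. This index map has Borel preimages by an
  argument of A. H. Stone, and composed with \<open>F\<close> it has an almost everywhere countable range. Hence
  distances between Borel maps are measurable up to null sets, and the spaces of integrable maps do
  satisfy the triangle inequality.

  For the currying map, replace \<open>f\<close> by an almost everywhere equal map with countable range. Its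
  sections then lie in a separable set of maps, because this holds for the sections of a product
  measurable set, and so \<open>x \<mapsto> f (x, \<cdot>)\<close> is Borel. For surjectivity, let \<open>G\<close> be a Borel map from \<open>X\<close> to
  the classes of maps \<open>Y \<rightarrow> D\<close>. Choose \<open>g\<^sub>n\<close> whose classes are dense in the essential range of \<open>G\<close> and
  let \<open>F\<^sub>k (x, y) = g\<^sub>n y\<close>, where \<open>n\<close> is least with the class of \<open>g\<^sub>n\<close> at distance less than \<open>(1/2)^k\<close> from
  \<open>G x\<close>. These distances are summable, so by the Borel-Cantelli lemma on each fibre \<open>F\<^sub>k (x, y)\<close> is
  eventually constant in \<open>k\<close> for almost every \<open>y\<close>, and its eventual value is the required preimage of \<open>G\<close>.
\<close>

section \<open>Borel embeddings into Polish spaces\<close>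

text \<open>The images of all measurable sets are required to be Borel, so that \<open>i\<close> is an isomorphism of
  measurable spaces onto a Borel set. The property passes to products and makes no reference to a
  topology on \<open>M\<close>.\<close>
definition borel_embedding ::
  "'a measure \<Rightarrow> ('a \<Rightarrow> 'p::{second_countable_topology, complete_space}) \<Rightarrow> bool" where
  "borel_embedding M i \<longleftrightarrow>
     i \<in> borel_measurable M \<and> inj_on i (space M) \<and> (\<forall>A\<in>sets M. i ` A \<in> sets borel)"

lemma image_sigma_sets_borel:
  assumes inj: "inj_on i S" and G: "G \<subseteq> Pow S" and S: "i ` S \<in> sets borel"
    and gen: "\<And>A. A \<in> G \<Longrightarrow> i ` A \<in> sets borel"
    and A: "A \<in> sigma_sets S G"
  shows "i ` A \<in> sets borel"
  using A
proof induction
  case (Compl a)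
  have "a \<subseteq> S" using Compl.hyps G by (rule sigma_sets_into_sp[rotated])
  then have "i ` (S - a) = i ` S - i ` a" using inj by (simp add: inj_on_image_set_diff)
  then show ?case using S Compl by auto
qed (auto simp: gen image_UN)

text \<open>This is the reason why a Polish space is a Borel subset of \<open>nat \<Rightarrow> real\<close> when its points are
  recorded by their distances to a dense sequence: being such a record means that arbitrarily good
  approximations \<open>q n\<close> exist, and completeness turns them into a point. The condition is visibly
  Borel, since only countably many coordinates and quantifiers occur in it.\<close>
lemma (in Metric_space) dist_image_borel:
  fixes q :: "nat \<Rightarrow> 'a"
  assumes q: "\<And>n. q n \<in> M" and dense: "\<And>x r. x \<in> M \<Longrightarrow> 0 < r \<Longrightarrow> \<exists>n. d x (q n) < r"
    and complete: mcomplete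
  shows "(\<lambda>x n. d x (q n)) ` M =
    {w. \<forall>k. \<exists>n. w n < inverse (real (Suc k)) \<and> (\<forall>m. \<bar>w m - d (q n) (q m)\<bar> \<le> inverse (real (Suc k)))}"
    (is "?i ` M = ?W")
proof
  show "?i ` M \<subseteq> ?W"
  proof clarify
    fix x and k :: nat assume x: "x \<in> M"
    obtain n where n: "d x (q n) < inverse (real (Suc k))"
      using dense[OF x, of "inverse (real (Suc k))"] by auto
    have "\<bar>d x (q m) - d (q n) (q m)\<bar> \<le> d x (q n)" for m
      using triangle[OF x q[of n] q[of m]] triangle[OF q[of n] x q[of m]] commute[of x "q n"]
      by linarith
    then show "\<exists>n. d x (q n) < inverse (real (Suc k)) \<and>
        (\<forall>m. \<bar>d x (q m) - d (q n) (q m)\<bar> \<le> inverse (real (Suc k)))"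
      using n by (meson less_eq_real_def order_trans)
  qed
next
  show "?W \<subseteq> ?i ` M"
  proof
    fix w assume "w \<in> ?W"
    then obtain p where p: "\<And>k. w (p k) < inverse (real (Suc k))"
      and pm: "\<And>k m. \<bar>w m - d (q (p k)) (q m)\<bar> \<le> inverse (real (Suc k))"
      by simp metis
    \<comment> \<open>The point \<open>q (p k)\<close> nearly has the distances recorded in \<open>w\<close>, and \<open>w (p l)\<close> is small.\<close>
    have near: "d (q (p k)) (q (p l)) < inverse (real (Suc k)) + inverse (real (Suc l))" for k l
      using p[of l] pm[of "p l" k] by linarith
    have "MCauchy (\<lambda>k. q (p k))"
      unfolding MCauchy_def
    proof (intro conjI allI impI)
      show "range (\<lambda>k. q (p k)) \<subseteq> M" using q by auto
      fix e :: real assume "0 < e"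
      then obtain N where N: "inverse (real (Suc N)) < e/2" using reals_Archimedean[of "e/2"] by auto
      have "d (q (p k)) (q (p l)) < e" if "N \<le> k" "N \<le> l" for k l
      proof -
        have "inverse (real (Suc k)) \<le> inverse (real (Suc N))" "inverse (real (Suc l)) \<le> inverse (real (Suc N))"
          using that by (auto intro!: le_imp_inverse_le)
        then show ?thesis using near[of k l] N by linarith
      qed
      then show "\<exists>N. \<forall>n n'. N \<le> n \<longrightarrow> N \<le> n' \<longrightarrow> d (q (p n)) (q (p n')) < e" by blast
    qed
    then obtain z where lim: "limitin mtopology (\<lambda>k. q (p k)) z sequentially"
      using complete unfolding mcomplete_def by blast
    then have z: "z \<in> M" by (meson limitin_mspace)
    have "w m = d z (q m)" for m
    proof (rule LIMSEQ_unique)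
      show "(\<lambda>k. d (q (p k)) (q m)) \<longlonglongrightarrow> w m"
      proof (rule metric_LIMSEQ_I)
        fix e :: real assume "0 < e"
        then obtain N where N: "inverse (real (Suc N)) < e" using reals_Archimedean by auto
        have "dist (d (q (p k)) (q m)) (w m) < e" if "N \<le> k" for k
        proof -
          have "inverse (real (Suc k)) \<le> inverse (real (Suc N))"
            using that by (auto intro!: le_imp_inverse_le)
          then show ?thesis using pm[of m k] N unfolding dist_real_def by linarith
        qed
        then show "\<exists>no. \<forall>n\<ge>no. dist (d (q (p n)) (q m)) (w m) < e" by blast
      qed
      have "(\<lambda>k. d (q (p k)) z) \<longlonglongrightarrow> 0" using lim by (simp add: limitin_metric_dist_null)
      then show "(\<lambda>k. d (q (p k)) (q m)) \<longlonglongrightarrow> d z (q m)"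
      proof (rule Lim_transform_bound[rotated 1, THEN Lim_transform[rotated 1]])
        show "\<forall>\<^sub>F k in sequentially. norm (d (q (p k)) (q m) - d z (q m)) \<le> norm (d (q (p k)) z)"
          using mdist_reverse_triangle[OF _ q z] q z
          by (intro always_eventually allI)
             (smt (verit, best) commute real_norm_def triangle)
      qed auto
    qed
    then show "w \<in> ?i ` M" using z by auto
  qed
qed

text \<open>Balls around the points of the dense sequence generate the Borel sets and correspond to conditions
  on a single coordinate, so images of Borel sets are Borel as soon as the image of the whole space is.\<close>
lemma standard_borel_space_embedding:
  assumes "standard_borel_space M"
  obtains i :: "'a \<Rightarrow> nat \<Rightarrow> real" where "borel_embedding (M :: 'a measure) i"
proof (cases "space M = {}")
  case True
  then have "sets M = {{}}" by (metis sets_eq_bot space_empty_eq_bot sets_bot)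
  then have "borel_embedding M (\<lambda>_ _. 0)"
    using True by (auto simp: borel_embedding_def measurable_def)
  then show ?thesis using that by blast
next
  case False
  obtain T where T: "completely_metrizable_space T" "second_countable T" "topspace T = space M"
    and sets_M: "sets M = sigma_sets (space M) {U. openin T U}"
    using assms unfolding standard_borel_space_def by blast
  obtain S d where "Metric_space S d" and complete: "Metric_space.mcomplete S d"
    and Td: "T = Metric_space.mtopology S d"
    using T(1) unfolding completely_metrizable_space_def by blast
  then interpret Metric_space S d by simp
  have S: "S = space M" using T(3) Td by simp
  have "separable_space mtopology" using T(2) Td second_countable_imp_separable_space by blast
  then obtain Q where Q: "countable Q" "Q \<subseteq> S" "mtopology closure_of Q = S"
    unfolding separable_space_def by auto
  have "Q \<noteq> {}" using Q(3) False S by auto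
  define q where "q = from_nat_into Q"
  have q: "q n \<in> S" for n unfolding q_def using from_nat_into[OF \<open>Q \<noteq> {}\<close>] Q(2) by auto
  have dense: "\<exists>n. d x (q n) < r" if "x \<in> S" "0 < r" for x r
  proof -
    have "x \<in> mtopology closure_of Q" using Q(3) that by simp
    then have "\<forall>r>0. \<exists>y\<in>Q. y \<in> S \<and> d x y < r" by (simp add: metric_closure_of)
    then obtain y where "y \<in> Q" "d x y < r"
      using \<open>0 < r\<close> by blast
    then show ?thesis unfolding q_def using from_nat_into_surj[OF Q(1)] by metis
  qed
  define i where "i = (\<lambda>x n. d x (q n))"
  have inj: "inj_on i S"
  proof
    fix x y assume x: "x \<in> S" and y: "y \<in> S" and eq: "i x = i y"
    show "x = y"
    proof (rule ccontr)
      assume "x \<noteq> y"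
      then have "0 < d x y / 2" using x y by simp
      then obtain n where n: "d x (q n) < d x y / 2" using dense[OF x] by blast
      have "d y (q n) = d x (q n)" using fun_cong[OF eq, of n] by (simp add: i_def)
      then show False using triangle[OF x q[of n] y] n commute[of y "q n"] by linarith
    qed
  qed
  have opens: "openin T U \<Longrightarrow> U \<in> sets M" for U using sets_M by auto
  have meas: "i \<in> borel_measurable M"
  proof (rule measurable_coordinatewise_then_product)
    fix n
    have "{x \<in> space M. i x n < r} \<in> sets M" for r
    proof -
      have "{x \<in> space M. i x n < r} = mball (q n) r"
        unfolding S[symmetric] using q[of n] by (auto simp: i_def commute)
      then show ?thesis using opens Td by simp
    qed
    then show "(\<lambda>x. i x n) \<in> borel_measurable M" by (rule borel_measurableI_less)
  qed
  have iS: "i ` S \<in> sets borel"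
  proof -
    have [measurable]: "(\<lambda>w. w n) \<in> borel_measurable borel" for n :: nat
      by (rule measurable_product_coordinates)
    define P where "P = (\<lambda>w::nat \<Rightarrow> real. \<forall>k. \<exists>n. w n < inverse (real (Suc k)) \<and>
        (\<forall>m. \<bar>w m - d (q n) (q m)\<bar> \<le> inverse (real (Suc k))))"
    have "Measurable.pred borel P" unfolding P_def by measurable
    then have "{w \<in> space borel. P w} \<in> sets borel" by (rule predE)
    moreover have "i ` S = Collect P"
      unfolding i_def P_def
    proof (rule dist_image_borel)
      show "\<exists>n. d x (q n) < r" if "x \<in> S" "0 < r" for x r using dense that by blast
    qed (simp_all add: q complete)
    ultimately show ?thesis by simp
  qed
  have ball: "i ` mball (q n) r \<in> sets borel" for n r
  proof -
    have "i ` mball (q n) r = i ` S \<inter> {w. w n < r}"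
    proof -
      have "x \<in> mball (q n) r \<longleftrightarrow> x \<in> S \<and> i x n < r" for x
        using q[of n] commute[of x "q n"] by (simp add: i_def)
      then show ?thesis by blast
    qed
    also have "\<dots> \<in> sets borel"
    proof -
      have "(\<lambda>w::nat \<Rightarrow> real. w n) \<in> borel_measurable borel"
        by (rule measurable_product_coordinates)
      then have "{w \<in> space borel. w n < r} \<in> sets borel" by (rule borel_measurable_less) simp
      then show ?thesis using iS by simp
    qed
    finally show ?thesis .
  qed
  have img: "i ` U \<in> sets borel" if U: "openin T U" for U
  proof -
    have U_eq: "U = (\<Union>(n,r)\<in>{(n,r). r \<in> \<rat> \<and> mball (q n) r \<subseteq> U}. mball (q n) r)" (is "_ = (\<Union>(n,r)\<in>?I. _)")
    proof (rule Set.set_eqI, rule iffI)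
      fix x assume "x \<in> U"
      then have "x \<in> S" using openin_subset[OF U] Td by auto
      obtain e where e: "0 < e" "mball x e \<subseteq> U"
        using U \<open>x \<in> U\<close> unfolding Td openin_mtopology by blast
      obtain r where r: "r \<in> \<rat>" "0 < r" "r < e/2" using Rats_dense_in_real[of 0 "e/2"] e by auto
      obtain n where n: "d x (q n) < r" using dense[OF \<open>x \<in> S\<close> r(2)] by blast
      have "mball (q n) r \<subseteq> mball x e"
      proof
        fix y assume "y \<in> mball (q n) r"
        then have y: "y \<in> S" "d (q n) y < r" by simp_all
        have "d x y < e" using triangle[OF \<open>x \<in> S\<close> q[of n] y(1)] y(2) n r by linarith
        then show "y \<in> mball x e" using \<open>x \<in> S\<close> y by simp
      qed
      then have "(n, r) \<in> ?I" using r e by auto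
      moreover have "x \<in> mball (q n) r" using n q[of n] \<open>x \<in> S\<close> commute[of x "q n"] by simp
      ultimately show "x \<in> (\<Union>(n,r)\<in>?I. mball (q n) r)" by blast
    qed auto
    have "countable ?I"
      by (rule countable_subset[of _ "UNIV \<times> \<rat>"]) (auto intro: countable_rat)
    have "i ` U = (\<Union>p\<in>?I. i ` (case p of (n,r) \<Rightarrow> mball (q n) r))"
      by (subst U_eq) (simp only: image_UN)
    also have "\<dots> \<in> sets borel"
      using \<open>countable ?I\<close> by (intro sets.countable_UN') (auto simp: ball)
    finally show ?thesis .
  qed
  have "borel_embedding M i"
    unfolding borel_embedding_def
  proof (intro conjI ballI)
    show "i \<in> borel_measurable M" by (rule meas)
    show "inj_on i (space M)" using inj S by simp
    fix A assume "A \<in> sets M"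
    then show "i ` A \<in> sets borel"
      using image_sigma_sets_borel[of i S "{U. openin T U}" A] inj iS img openin_subset[of T] T(3) S
      by (auto simp: sets_M)
  qed
  then show ?thesis using that by blast
qed

lemma borel_embedding_pair:
  assumes i: "borel_embedding M i" and j: "borel_embedding N j"
  shows "borel_embedding (M \<Otimes>\<^sub>M N) (\<lambda>(x, y). (i x, j y))"
  unfolding borel_embedding_def
proof (intro conjI ballI)
  have [measurable]: "i \<in> borel_measurable M" "j \<in> borel_measurable N"
    using i j by (auto simp: borel_embedding_def)
  show "(\<lambda>(x, y). (i x, j y)) \<in> borel_measurable (M \<Otimes>\<^sub>M N)" by measurable
  show inj: "inj_on (\<lambda>(x, y). (i x, j y)) (space (M \<Otimes>\<^sub>M N))"
    using i j by (auto simp: borel_embedding_def space_pair_measure inj_on_def)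
  have rect: "(\<lambda>(x, y). (i x, j y)) ` (A \<times> B) \<in> sets borel" if "A \<in> sets M" "B \<in> sets N" for A B
  proof -
    have "(\<lambda>(x, y). (i x, j y)) ` (A \<times> B) = i ` A \<times> j ` B" by auto
    also have "\<dots> \<in> sets (borel \<Otimes>\<^sub>M borel)"
      using i j that by (intro pair_measureI) (auto simp: borel_embedding_def)
    finally show ?thesis by (simp only: borel_prod)
  qed
  fix A assume "A \<in> sets (M \<Otimes>\<^sub>M N)"
  then show "(\<lambda>(x, y). (i x, j y)) ` A \<in> sets borel"
    unfolding sets_pair_measure
  proof (rule image_sigma_sets_borel[rotated 4])
    show "inj_on (\<lambda>(x, y). (i x, j y)) (space M \<times> space N)"
      using inj by (simp add: space_pair_measure)
    show "{a \<times> b |a b. a \<in> sets M \<and> b \<in> sets N} \<subseteq> Pow (space M \<times> space N)"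
      by (rule pair_measure_closed)
  qed (auto simp: rect)
qed

section \<open>Perfectness of measures on standard spaces\<close>

text \<open>The set \<open>V\<close> itself need not be Borel. The graph map \<open>z \<mapsto> (h z, i z)\<close> turns \<open>h -` V\<close> into a Borel set in a
  Polish space, where measures are inner regular. The first projection of a compact part of
  this set is a compact subset of \<open>V\<close>.\<close>
lemma null_vimage_of_compact_null:
  fixes h :: "'a \<Rightarrow> real" and i :: "'a \<Rightarrow> 'p::{second_countable_topology, complete_space}"
  assumes "finite_measure M" and emb: "borel_embedding M i" and h: "h \<in> borel_measurable M"
    and V: "h -` V \<inter> space M \<in> sets M"
    and null: "\<And>K. compact K \<Longrightarrow> K \<subseteq> V \<Longrightarrow> emeasure M (h -` K \<inter> space M) = 0"
  shows "emeasure M (h -` V \<inter> space M) = 0"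
proof -
  interpret finite_measure M by fact
  define A where "A = h -` V \<inter> space M"
  define k where "k = (\<lambda>z. (h z, i z))"
  \<comment> \<open>The function \<open>h\<close> transported to the Polish space, so that the graph is described by Borel conditions.\<close>
  define h' where "h' = (\<lambda>w. if w \<in> i ` space M then h (the_inv_into (space M) i w) else 0)"
  have [measurable]: "i \<in> borel_measurable M" and inj: "inj_on i (space M)"
    and img: "\<And>B. B \<in> sets M \<Longrightarrow> i ` B \<in> sets borel"
    using emb by (auto simp: borel_embedding_def)
  have [measurable]: "h' \<in> borel_measurable borel"
  proof (rule measurableI)
    fix B :: "real set" assume B: "B \<in> sets borel"
    have "h' -` B \<inter> space borel =
      i ` (h -` B \<inter> space M) \<union> (if 0 \<in> B then UNIV - i ` space M else {})"
      using inj by (auto simp: h'_def the_inv_into_f_f split: if_splits)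
    moreover have "i ` (h -` B \<inter> space M) \<in> sets borel" "i ` space M \<in> sets borel"
      using measurable_sets[OF h B] by (auto intro: img)
    ultimately show "h' -` B \<inter> space borel \<in> sets borel"
      by (simp only: sets.Un sets.compl_sets space_borel sets.empty_sets split: if_split) auto
  qed auto
  have kA: "k ` A \<in> sets borel"
  proof -
    have "k ` A = {p. fst p = h' (snd p) \<and> snd p \<in> i ` A}"
    proof (intro set_eqI iffI)
      fix p assume "p \<in> k ` A"
      then obtain z where "z \<in> A" "p = (h z, i z)" by (auto simp: k_def)
      then show "p \<in> {p. fst p = h' (snd p) \<and> snd p \<in> i ` A}"
        using inj by (auto simp: h'_def A_def the_inv_into_f_f)
    next
      fix p assume "p \<in> {p. fst p = h' (snd p) \<and> snd p \<in> i ` A}"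
      then obtain z where z: "z \<in> A" "snd p = i z" "fst p = h' (i z)" by auto
      then have "p = k z"
        using inj by (intro prod_eqI) (auto simp: k_def h'_def A_def the_inv_into_f_f)
      then show "p \<in> k ` A" using z by blast
    qed
    also have "\<dots> \<in> sets (borel \<Otimes>\<^sub>M borel)"
    proof -
      have [measurable]: "i ` A \<in> sets borel" using img V A_def by auto
      have "{p \<in> space (borel \<Otimes>\<^sub>M borel). fst p = h' (snd p) \<and> snd p \<in> i ` A} \<in> sets (borel \<Otimes>\<^sub>M borel)"
        by measurable
      then show ?thesis by (simp add: space_pair_measure)
    qed
    finally show ?thesis by (simp only: borel_prod)
  qed
  have k[measurable]: "k \<in> borel_measurable M" unfolding k_def using h by measurable
  define \<kappa> where "\<kappa> = distr M borel k"
  have "k -` k ` A \<inter> space M = A"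
    using inj by (auto simp: k_def A_def inj_on_def)
  then have "emeasure M A = emeasure \<kappa> (k ` A)"
    unfolding \<kappa>_def by (simp add: emeasure_distr kA)
  also have "\<dots> = (SUP K\<in>{K. K \<subseteq> k ` A \<and> compact K}. emeasure \<kappa> K)"
  proof (rule inner_regular)
    show "emeasure \<kappa> (space \<kappa>) \<noteq> \<infinity>"
      unfolding \<kappa>_def using emeasure_finite by (simp add: emeasure_distr)
  qed (simp_all add: \<kappa>_def kA)
  also have "\<dots> \<le> 0"
  proof (rule SUP_least)
    fix K assume "K \<in> {K. K \<subseteq> k ` A \<and> compact K}"
    then have K: "K \<subseteq> k ` A" "compact K" by auto
    have cK: "compact (fst ` K)" using K(2) by (intro compact_continuous_image continuous_intros)
    have "fst ` K \<subseteq> V" using K(1) by (auto simp: k_def A_def)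
    then have 0: "emeasure M (h -` fst ` K \<inter> space M) = 0" using null cK by blast
    have "emeasure \<kappa> K = emeasure M (k -` K \<inter> space M)"
      unfolding \<kappa>_def using K(2) by (simp add: emeasure_distr borel_compact)
    also have "\<dots> \<le> emeasure M (h -` fst ` K \<inter> space M)"
    proof (rule emeasure_mono)
      show "h -` fst ` K \<inter> space M \<in> sets M" using h cK borel_compact measurable_sets by blast
    qed (force simp: k_def)
    finally show "emeasure \<kappa> K \<le> 0" using 0 by simp
  qed
  finally show ?thesis by (simp add: A_def)
qed

section \<open>A countable cover of the line without large compact subsets\<close>

text \<open>The pieces are the rational translates of a Vitali set. Infinitely many disjoint translates of a
  compact subset of one piece fit into a bounded interval, so that it is null.\<close>
lemma vitali_cover_of_reals:
  obtains V :: "nat \<Rightarrow> real set"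
  where "(\<Union>n. V n) = UNIV" "\<And>n K. compact K \<Longrightarrow> K \<subseteq> V n \<Longrightarrow> emeasure lborel K = 0"
proof -
  \<comment> \<open>\<open>s\<close> selects a representative of each coset of the rationals; \<open>V q\<close> is the set of representatives moved by \<open>q\<close>.\<close>
  define s where "s = (\<lambda>x::real. SOME y. x - y \<in> \<rat>)"
  have s: "x - s x \<in> \<rat>" for x
    unfolding s_def by (rule someI[of _ x]) simp
  have s_eq: "s x = s y" if "x - y \<in> \<rat>" for x y
  proof -
    have "(x - z \<in> \<rat>) = (y - z \<in> \<rat>)" for z
      using Rats_diff[OF _ that, of "x - z"] Rats_add[OF _ that, of "y - z"] by auto
    then show ?thesis by (simp add: s_def)
  qed
  define V where "V = (\<lambda>q. {x. x - s x = q})"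
  have null: "emeasure lborel K = 0" if K: "compact K" "K \<subseteq> V q" for K q
  proof (rule ccontr)
    assume pos: "emeasure lborel K \<noteq> 0"
    obtain b where b: "\<And>x. x \<in> K \<Longrightarrow> \<bar>x\<bar> \<le> b"
      using compact_imp_bounded[OF K(1)] by (auto simp: bounded_iff)
    define T where "T = (\<lambda>n::nat. (+) (inverse (real (Suc n))) ` K)"
    have T[measurable]: "T n \<in> sets lborel" for n
      unfolding T_def by (simp add: borel_compact compact_translation[OF K(1)] del: of_nat_Suc)
    have eT: "emeasure lborel (T n) = emeasure lborel K" for n
    proof -
      have "emeasure lborel (T n) = emeasure (distr lborel borel ((+) (inverse (real (Suc n))))) (T n)"
        by (simp add: lborel_distr_plus)
      also have "\<dots> = emeasure lborel K"
        using T[of n] unfolding T_def by (subst emeasure_distr) (auto simp: inj_vimage_image_eq)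
      finally show ?thesis .
    qed
    have disj: "disjoint_family T"
      unfolding disjoint_family_on_def
    proof clarify
      fix m n :: nat assume "m \<noteq> n"
      show "T m \<inter> T n = {}"
      proof (rule ccontr)
        assume "T m \<inter> T n \<noteq> {}"
        then obtain x y where xy: "x \<in> K" "y \<in> K"
          "inverse (real (Suc m)) + x = inverse (real (Suc n)) + y"
          unfolding T_def by auto
        then have "x - y = inverse (real (Suc n)) - inverse (real (Suc m))" by simp
        also have "\<dots> \<in> \<rat>" by (intro Rats_diff Rats_inverse Rats_of_nat)
        finally have "s x = s y" by (rule s_eq)
        moreover have "x - s x = y - s y" using xy K(2) by (auto simp: V_def)
        ultimately have "x = y" by simp
        then show False using xy \<open>m \<noteq> n\<close> by simp
      qed
    qed
    have "(\<Sum>n. emeasure lborel (T n)) = emeasure lborel (\<Union>n. T n)"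
      using T disj by (intro suminf_emeasure) auto
    also have "\<dots> \<le> emeasure lborel {-b..b+1}"
    proof (rule emeasure_mono)
      show "(\<Union>n. T n) \<subseteq> {-b..b+1}"
      proof clarify
        fix n x assume "x \<in> T n"
        then obtain y where y: "y \<in> K" "x = inverse (real (Suc n)) + y" by (auto simp: T_def)
        have "0 \<le> inverse (real (Suc n))" "inverse (real (Suc n)) \<le> 1" by (auto simp: field_simps)
        then have "-b \<le> x \<and> x \<le> b + 1" using b[OF y(1)] unfolding y(2) by linarith
        then show "x \<in> {-b..b+1}" by simp
      qed
    qed simp
    also have "\<dots> < \<infinity>" by (simp add: emeasure_lborel_Icc_eq)
    finally have "(\<Sum>n::nat. emeasure lborel K) < \<infinity>" by (simp add: eT)
    moreover have "emeasure lborel K = ennreal (measure lborel K)"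
      using emeasure_compact_finite[OF K(1)] by (intro emeasure_eq_ennreal_measure) simp
    ultimately have "summable (\<lambda>n::nat. measure lborel K)"
      by (intro summable_suminf_not_top) auto
    then show False
      using pos \<open>emeasure lborel K = ennreal _\<close> by (simp add: summable_const_iff)
  qed
  have "countable (\<rat> :: real set)" by (rule countable_rat)
  moreover have "(\<rat> :: real set) \<noteq> {}" by auto
  ultimately have r: "range (from_nat_into (\<rat> :: real set)) = \<rat>" by (intro range_from_nat_into)
  show ?thesis
  proof (rule that)
    show "(\<Union>n. V (from_nat_into \<rat> n)) = UNIV"
      using s by (auto simp: V_def set_eq_iff) (metis r rangeE)
  qed (rule null)
qed

section \<open>Discrete-valued maps have essentially countable range\<close>

text \<open>Without atoms the distribution function is continuous and its own distribution is uniform on the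
  unit interval, hence absolutely continuous.\<close>
lemma cdf_vimage_null:
  fixes \<nu> :: "real measure"
  assumes "real_distribution \<nu>" and atomless: "\<And>x. measure \<nu> {x} = 0"
    and B: "B \<in> sets borel" "emeasure lborel B = 0"
  shows "emeasure \<nu> (cdf \<nu> -` B) = 0"
proof -
  interpret real_distribution \<nu> by fact
  have cont: "isCont (cdf \<nu>) x" for x by (simp add: isCont_cdf atomless)
  have meas: "cdf \<nu> \<in> borel_measurable \<nu>"
    unfolding measurable_cong_sets[OF M_is_borel refl]
    by (rule borel_measurable_mono) (auto simp: mono_def cdf_nondecreasing)
  have inner: "measure \<nu> {x. cdf \<nu> x \<le> t} = t" if t: "0 < t" "t < 1" for t
  proof -
    have "\<exists>x. cdf \<nu> x \<le> t" "\<exists>x. t \<le> cdf \<nu> x"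
      using order_tendstoD(2)[OF cdf_lim_at_bot t(1)] order_tendstoD(1)[OF cdf_lim_at_top_prob t(2)]
      by (auto simp: eventually_at_bot_linorder eventually_at_top_linorder intro: less_imp_le)
    then obtain a b where ab: "cdf \<nu> a \<le> t" "t \<le> cdf \<nu> b" by blast
    obtain c where c: "cdf \<nu> c = t"
      using IVT[of "cdf \<nu>" a t b] ab cont cdf_nondecreasing[of b a] by (metis linear order_antisym order_trans)
    obtain u where u: "t < cdf \<nu> u"
      using order_tendstoD(1)[OF cdf_lim_at_top_prob t(2)] by (auto simp: eventually_at_top_linorder)
    \<comment> \<open>The sublevel set of \<open>t\<close> is the half-line up to the largest point where the value \<open>t\<close> is taken.\<close>
    define L where "L = {x. cdf \<nu> x = t}"
    have "closed L" unfolding L_def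
      by (intro closed_Collect_eq continuous_at_imp_continuous_on continuous_on_const ballI) (auto simp: cont)
    moreover have "bdd_above L" unfolding L_def
    proof (rule bdd_aboveI[of _ u])
      fix x assume "x \<in> {x. cdf \<nu> x = t}"
      then show "x \<le> u" using u cdf_nondecreasing[of u x] by (cases "x \<le> u") auto
    qed
    moreover have "L \<noteq> {}" using c by (auto simp: L_def)
    ultimately have SL: "Sup L \<in> L" by (simp add: closed_contains_Sup)
    have "cdf \<nu> x \<le> t \<longleftrightarrow> x \<le> Sup L" for x
    proof
      assume "x \<le> Sup L"
      then show "cdf \<nu> x \<le> t" using cdf_nondecreasing[of x "Sup L"] SL by (simp add: L_def)
    next
      assume x: "cdf \<nu> x \<le> t"
      show "x \<le> Sup L"
      proof (rule ccontr)
        assume "\<not> x \<le> Sup L"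
        then have "t \<le> cdf \<nu> x" using cdf_nondecreasing[of "Sup L" x] SL by (auto simp: L_def)
        then have "x \<in> L" using x by (simp add: L_def)
        then show False using \<open>\<not> x \<le> Sup L\<close> cSup_upper \<open>bdd_above L\<close> by blast
      qed
    qed
    then have "{x. cdf \<nu> x \<le> t} = {..Sup L}" by auto
    then show ?thesis using SL by (simp add: cdf_def L_def)
  qed
  have "distributed \<nu> lborel (cdf \<nu>) (\<lambda>x. indicator {0..1} x / measure lborel {0..1::real})"
  proof (rule uniform_distrI_borel_atLeastAtMost[OF meas])
    fix t :: real assume t: "0 \<le> t" "t \<le> 1"
    consider "t = 0" | "t = 1" | "0 < t" "t < 1" using t by linarith
    then show "\<P>(x in \<nu>. cdf \<nu> x \<le> t) = (t - 0) / (1 - 0)"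
    proof cases
      case 1
      have "measure \<nu> {x. cdf \<nu> x \<le> 0} \<le> e" if "0 < e" for e
      proof -
        define d where "d = min e (1/2)"
        have "{x. cdf \<nu> x \<le> d} \<in> sets \<nu>"
          using meas by (auto intro: borel_measurable_le)
        then have "measure \<nu> {x. cdf \<nu> x \<le> 0} \<le> measure \<nu> {x. cdf \<nu> x \<le> d}"
          using that by (intro finite_measure_mono) (auto simp: d_def)
        also have "\<dots> \<le> e" using inner[of d] that by (simp add: d_def)
        finally show ?thesis .
      qed
      then show ?thesis using 1 measure_nonneg field_le_epsilon[of "measure \<nu> {x. cdf \<nu> x \<le> 0}" 0]
        by (simp add: antisym)
    next
      case 2
      then show ?thesis using prob_space cdf_bounded_prob by simp
    next
      case 3
      then show ?thesis using inner by simp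
    qed
  qed simp
  then have "distr \<nu> lborel (cdf \<nu>) = density lborel (\<lambda>x. indicator {0..1} x / measure lborel {0..1::real})"
    by (simp add: distributed_distr_eq_density)
  moreover have "B \<in> null_sets (density lborel (\<lambda>x. ennreal (indicator {0..1} x / measure lborel {0..1::real})))"
  proof -
    have "B \<in> null_sets lborel" using B by auto
    then have "AE x in lborel. x \<notin> B" by (rule AE_not_in)
    then show ?thesis using B by (subst null_sets_density_iff) (auto elim: eventually_mono)
  qed
  ultimately have "emeasure (distr \<nu> lborel (cdf \<nu>)) B = 0" by auto
  then show ?thesis using B meas by (subst (asm) emeasure_distr) auto
qed

text \<open>A point is determined by the set of basic open sets that contain it, and there are as many sets
  of natural numbers as reals.\<close>
lemma ex_inj_second_countable_real:
  obtains g :: "'p::{second_countable_topology, t0_space} \<Rightarrow> real" where "inj g"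
proof -
  obtain B :: "'p set set" where B: "countable B" "topological_basis B"
    using ex_countable_basis by blast
  define S where "S = (\<lambda>x. to_nat_on B ` {b \<in> B. x \<in> b})"
  have S: "x \<in> b \<longleftrightarrow> to_nat_on B b \<in> S x" if "b \<in> B" for b x
    using that inj_on_to_nat_on[OF B(1)] unfolding inj_on_def S_def by blast
  have "inj S"
  proof
    fix x y assume eq: "S x = S y"
    have *: "x \<in> b \<longleftrightarrow> y \<in> b" if "b \<in> B" for b
      unfolding S[OF that] eq ..
    show "x = y"
    proof (rule ccontr)
      assume "x \<noteq> y"
      then obtain U where U: "open U" "\<not> (x \<in> U \<longleftrightarrow> y \<in> U)" using separation_t0[of x y] by metis
      obtain B' where "B' \<subseteq> B" "\<Union>B' = U" using B(2) U(1) unfolding topological_basis_def by blast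
      then show False using * U(2) by blast
    qed
  qed
  moreover obtain c :: "nat set \<Rightarrow> real" where "inj c"
    using nat_sets_eqpoll_reals by (auto simp: eqpoll_def bij_betw_def)
  ultimately show ?thesis using that inj_compose by blast
qed

text \<open>All preimages under \<open>f\<close> are measurable, so \<open>f\<close> may be followed by arbitrary maps. In particular its
  values may be replaced by points of the fibres, which are at most as many as the reals. This
  excludes large cardinals among the possible ranges.\<close>
lemma no_diffuse_discrete_map:
  fixes i :: "'a \<Rightarrow> 'p::{second_countable_topology, complete_space}"
  assumes "prob_space M" and emb: "borel_embedding M i"
    and f: "\<And>A. f -` A \<inter> space M \<in> sets M"
    and null: "\<And>d. emeasure M (f -` {d} \<inter> space M) = 0"
  shows False
proof -
  interpret prob_space M by fact
  have inj_i: "inj_on i (space M)" using emb by (simp add: borel_embedding_def)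
  obtain c :: "'p \<Rightarrow> real" where c: "inj c" by (rule ex_inj_second_countable_real)
  define s where "s = (\<lambda>d. SOME z. z \<in> space M \<and> f z = d)"
  have s: "s (f z) \<in> space M \<and> f (s (f z)) = f z" if "z \<in> space M" for z
    unfolding s_def by (rule someI[of _ z]) (simp add: that)
  \<comment> \<open>\<open>g\<close> has the same fibres as \<open>f\<close>, but real values; \<open>h\<close> below has uniform distribution in addition.\<close>
  define g where "g = (\<lambda>z. c (i (s (f z))))"
  have vimage_g: "g -` A \<inter> space M = f -` ((\<lambda>d. c (i (s d))) -` A) \<inter> space M" for A
    by (auto simp: g_def)
  then have g: "g -` A \<inter> space M \<in> sets M" for A using f by simp
  have g_null: "emeasure M (g -` {r} \<inter> space M) = 0" for r
  proof (cases "g -` {r} \<inter> space M = {}")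
    case False
    then obtain z where z: "z \<in> space M" "g z = r" by auto
    have "g -` {r} \<inter> space M \<subseteq> f -` {f z} \<inter> space M"
    proof
      fix y assume "y \<in> g -` {r} \<inter> space M"
      then have y: "y \<in> space M" "g y = r" by auto
      then have "i (s (f y)) = i (s (f z))" using z injD[OF c, of "i (s (f y))" "i (s (f z))"] by (simp add: g_def)
      then have "s (f y) = s (f z)"
        using inj_i s[OF y(1)] s[OF z(1)] by (auto dest: inj_onD)
      then have "f (s (f y)) = f (s (f z))" by simp
      then show "y \<in> f -` {f z} \<inter> space M" using s[OF y(1)] s[OF z(1)] y(1) by simp
    qed
    then have "emeasure M (g -` {r} \<inter> space M) \<le> emeasure M (f -` {f z} \<inter> space M)"
      using f by (rule emeasure_mono)
    then show ?thesis using null[of "f z"] by simp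
  qed simp
  have gm: "g \<in> borel_measurable M" by (rule measurableI) (use g in auto)
  define \<nu> where "\<nu> = distr M borel g"
  interpret \<nu>: real_distribution \<nu> unfolding \<nu>_def using gm by (rule real_distribution_distr)
  have atomless: "measure \<nu> {r} = 0" for r
    using g_null[of r] gm by (simp add: \<nu>_def measure_def emeasure_distr)
  have Fm: "cdf \<nu> \<in> borel_measurable borel"
    by (rule borel_measurable_mono) (auto simp: mono_def \<nu>.cdf_nondecreasing)
  define h where "h = (\<lambda>z. cdf \<nu> (g z))"
  have vimage_h: "h -` A \<inter> space M = g -` (cdf \<nu> -` A) \<inter> space M" for A by (auto simp: h_def)
  obtain V :: "nat \<Rightarrow> real set" where V: "(\<Union>n. V n) = UNIV"
    and V_null: "\<And>n K. compact K \<Longrightarrow> K \<subseteq> V n \<Longrightarrow> emeasure lborel K = 0"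
    using vitali_cover_of_reals by metis
  have "emeasure M (h -` V n \<inter> space M) = 0" for n
  proof (rule null_vimage_of_compact_null[OF _ emb])
    show "finite_measure M" by unfold_locales
    show "h \<in> borel_measurable M" unfolding h_def using gm Fm by measurable
    show "h -` V n \<inter> space M \<in> sets M" unfolding vimage_h by (rule g)
    fix K assume K: "compact K" "K \<subseteq> V n"
    then have "emeasure \<nu> (cdf \<nu> -` K) = 0"
      using V_null borel_compact by (intro cdf_vimage_null[OF _ atomless]) (auto intro: \<nu>.real_distribution_axioms)
    moreover have "cdf \<nu> -` K \<in> sets borel"
      using measurable_sets[OF Fm borel_compact[OF K(1)]] by simp
    ultimately show "emeasure M (h -` K \<inter> space M) = 0"
      unfolding vimage_h using gm by (simp add: \<nu>_def emeasure_distr)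
  qed
  then have "emeasure M (\<Union>n. h -` V n \<inter> space M) = 0"
    using g by (intro emeasure_UN_eq_0) (auto simp: vimage_h)
  moreover have "(\<Union>n. h -` V n \<inter> space M) = space M" using V by blast
  ultimately show False using emeasure_space_1 by simp
qed

text \<open>Only countably many fibres have positive measure. If the rest had positive measure, conditioning
  on it would produce a map with null fibres only.\<close>
lemma ae_countable_range:
  fixes i :: "'a \<Rightarrow> 'p::{second_countable_topology, complete_space}"
  assumes "prob_space M" and emb: "borel_embedding M i" and f: "f \<in> measurable M (count_space D)"
  obtains C where "countable C" "C \<subseteq> D" "AE z in M. f z \<in> C"
proof -
  interpret prob_space M by fact
  have fD: "f z \<in> D" if "z \<in> space M" for z using measurable_space[OF f that] by simp
  have vim: "f -` A \<inter> space M \<in> sets M" for A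
  proof -
    have "f -` A \<inter> space M = f -` (A \<inter> D) \<inter> space M" using fD by auto
    then show ?thesis using measurable_sets[OF f, of "A \<inter> D"] by simp
  qed
  have f': "f \<in> measurable M (count_space UNIV)" using vim by (auto intro: measurableI)
  interpret N: prob_space "distr M (count_space UNIV) f" using f' by (rule prob_space_distr)
  define C where "C = {d. prob (f -` {d} \<inter> space M) \<noteq> 0}"
  have C: "countable C" using N.countable_support f' by (simp add: C_def measure_distr)
  have CD: "C \<subseteq> D"
  proof
    fix d assume "d \<in> C"
    then have "f -` {d} \<inter> space M \<noteq> {}" by (auto simp: C_def)
    then show "d \<in> D" using fD by auto
  qed
  define B where "B = f -` (- C) \<inter> space M"
  have B: "B \<in> sets M" unfolding B_def by (rule vim)
  have "emeasure M B = 0"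
  proof (rule ccontr)
    assume pos: "emeasure M B \<noteq> 0"
    \<comment> \<open>Conditioning on \<open>B\<close> kills the fibres of positive measure, which are disjoint from \<open>B\<close>.\<close>
    show False
    proof (rule no_diffuse_discrete_map)
      show "prob_space (uniform_measure M B)"
        using pos emeasure_finite by (intro prob_space_uniform_measure) auto
      show "borel_embedding (uniform_measure M B) i"
        using emb by (simp add: borel_embedding_def cong: measurable_cong_sets)
      show "f -` A \<inter> space (uniform_measure M B) \<in> sets (uniform_measure M B)" for A
        using vim by simp
      show "emeasure (uniform_measure M B) (f -` {d} \<inter> space (uniform_measure M B)) = 0" for d
      proof -
        have "emeasure M (B \<inter> (f -` {d} \<inter> space M)) = 0"
        proof (cases "d \<in> C")
          case True
          then have "B \<inter> (f -` {d} \<inter> space M) = {}" by (auto simp: B_def)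
          then show ?thesis by simp
        next
          case False
          then have "emeasure M (f -` {d} \<inter> space M) = 0" by (simp add: C_def emeasure_eq_measure)
          moreover have "emeasure M (B \<inter> (f -` {d} \<inter> space M)) \<le> emeasure M (f -` {d} \<inter> space M)"
            by (intro emeasure_mono vim) blast
          ultimately show ?thesis by simp
        qed
        then show ?thesis using vim B by simp
      qed
    qed
  qed
  then have "AE z in M. f z \<in> C"
    by (intro AE_I[of _ _ B]) (auto simp: B_def vim)
  with C CD show ?thesis by (rule that)
qed

section \<open>Borel maps into pseudo-metric spaces\<close>

locale pseudo_metric =
  fixes E :: "'e pms"
  assumes pms: "pseudo_metric_space E"
begin

abbreviation "P \<equiv> pts E"
abbreviation "d \<equiv> pdist E"

lemma d_refl [simp]: "x \<in> P \<Longrightarrow> d x x = 0"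
  and d_nonneg [simp]: "x \<in> P \<Longrightarrow> y \<in> P \<Longrightarrow> 0 \<le> d x y"
  and d_sym: "x \<in> P \<Longrightarrow> y \<in> P \<Longrightarrow> d x y = d y x"
  and d_tri: "x \<in> P \<Longrightarrow> y \<in> P \<Longrightarrow> z \<in> P \<Longrightarrow> d x z \<le> d x y + d y z"
  using pms unfolding pseudo_metric_space_def by blast+

end

lemma space_pms_borel [simp]: "space (pms_borel E) = pts E"
  unfolding pms_borel_def by (rule space_measure_of) (auto simp: pms_open_def)

lemma sets_pms_borel: "sets (pms_borel E) = sigma_sets (pts E) {U. pms_open E U}"
  unfolding pms_borel_def by (rule sets_measure_of) (auto simp: pms_open_def)

lemma pms_open_sets: "pms_open E U \<Longrightarrow> U \<in> sets (pms_borel E)"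
  by (auto simp: sets_pms_borel)

lemma measurable_pms_borelI:
  assumes "\<And>z. z \<in> space M \<Longrightarrow> F z \<in> pts E"
    and "\<And>U. pms_open E U \<Longrightarrow> F -` U \<inter> space M \<in> sets M"
  shows "F \<in> measurable M (pms_borel E)"
  unfolding pms_borel_def
  by (rule measurable_sigma_sets[where \<Omega> = "pts E" and A = "{U. pms_open E U}"])
     (use assms in \<open>auto simp: pms_open_def sets_pms_borel[unfolded pms_borel_def]\<close>)

lemma measurable_pms_borel_lipschitz:
  assumes F: "\<And>x. x \<in> pts E \<Longrightarrow> F x \<in> pts E'"
    and lip: "\<And>x y. x \<in> pts E \<Longrightarrow> y \<in> pts E \<Longrightarrow> pdist E' (F x) (F y) \<le> pdist E x y"
  shows "F \<in> measurable (pms_borel E) (pms_borel E')"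
proof (rule measurable_pms_borelI)
  fix U assume U: "pms_open E' U"
  have "pms_open E (F -` U \<inter> pts E)"
    unfolding pms_open_def
  proof (intro conjI ballI)
    fix x assume x: "x \<in> F -` U \<inter> pts E"
    then obtain r where "0 < r" and r: "\<And>y. y \<in> pts E' \<Longrightarrow> pdist E' (F x) y < r \<Longrightarrow> y \<in> U"
      using U unfolding pms_open_def by blast
    have "y \<in> F -` U \<inter> pts E" if "y \<in> pts E" "pdist E x y < r" for y
      using r[OF F[OF that(1)]] lip[of x y] x that by auto
    then show "\<exists>r>0. \<forall>y\<in>pts E. pdist E x y < r \<longrightarrow> y \<in> F -` U \<inter> pts E" using \<open>0 < r\<close> by blast
  qed auto
  then show "F -` U \<inter> space (pms_borel E) \<in> sets (pms_borel E)" by (simp add: pms_open_sets)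
qed (simp add: F)

context pseudo_metric
begin

lemma measurable_pdist:
  assumes s: "s \<in> P"
  shows "(\<lambda>x. d x s) \<in> borel_measurable (pms_borel E)"
proof (rule borel_measurableI_less)
  fix r
  have "pms_open E {x \<in> P. d x s < r}"
    unfolding pms_open_def
  proof (intro conjI ballI)
    fix x assume x: "x \<in> {x \<in> P. d x s < r}"
    have "d y s < r" if "y \<in> P" "d x y < r - d x s" for y
      using d_tri[of y x s] d_sym[of x y] that x s by auto
    then show "\<exists>e>0. \<forall>y\<in>P. d x y < e \<longrightarrow> y \<in> {x \<in> P. d x s < r}"
      using x by (intro exI[of _ "r - d x s"]) auto
  qed auto
  then show "{x \<in> space (pms_borel E). d x s < r} \<in> sets (pms_borel E)" by (simp add: pms_open_sets)
qed

text \<open>In general the open balls do not generate the Borel sets of \<open>E\<close>. Near a countable dense subset of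
  the values every open set is a countable union of balls, so measurability of distances suffices.\<close>
lemma borel_measurable_into_separable:
  assumes F: "\<And>z. z \<in> space M \<Longrightarrow> F z \<in> P"
    and S: "countable S" "S \<subseteq> P"
    and dense: "\<And>z \<epsilon>. z \<in> space M \<Longrightarrow> 0 < \<epsilon> \<Longrightarrow> \<exists>s\<in>S. d (F z) s < \<epsilon>"
    and meas: "\<And>s. s \<in> S \<Longrightarrow> (\<lambda>z. d (F z) s) \<in> borel_measurable M"
  shows "F \<in> measurable M (pms_borel E)"
proof (rule measurable_pms_borelI)
  fix U assume U: "pms_open E U"
  \<comment> \<open>The balls with centre in \<open>S\<close> and radius \<open>1 / (n + 1)\<close> that are contained in \<open>U\<close>.\<close>
  define I where "I = {(s, n). s \<in> S \<and> (\<forall>y\<in>P. d s y < inverse (real (Suc n)) \<longrightarrow> y \<in> U)}"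
  have "F -` U \<inter> space M = (\<Union>(s, n)\<in>I. {z \<in> space M. d (F z) s < inverse (real (Suc n))})"
  proof (intro set_eqI iffI)
    fix z assume z: "z \<in> F -` U \<inter> space M"
    then obtain r where r: "0 < r" "\<And>y. y \<in> P \<Longrightarrow> d (F z) y < r \<Longrightarrow> y \<in> U"
      using U unfolding pms_open_def by blast
    obtain n where n: "inverse (real (Suc n)) < r / 2" using r(1) reals_Archimedean[of "r/2"] by auto
    obtain s where s: "s \<in> S" "d (F z) s < inverse (real (Suc n))"
      using dense[of z "inverse (real (Suc n))"] z by auto
    have "y \<in> U" if "y \<in> P" "d s y < inverse (real (Suc n))" for y
    proof -
      have "d (F z) y \<le> d (F z) s + d s y" using d_tri F z s(1) S(2) that(1) by blast
      then show ?thesis using r(2)[OF that(1)] s(2) that(2) n by linarith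
    qed
    then have "(s, n) \<in> I" using s(1) by (auto simp: I_def)
    then show "z \<in> (\<Union>(s, n)\<in>I. {z \<in> space M. d (F z) s < inverse (real (Suc n))})"
      using s(2) z by blast
  next
    fix z assume "z \<in> (\<Union>(s, n)\<in>I. {z \<in> space M. d (F z) s < inverse (real (Suc n))})"
    then obtain s n where "(s, n) \<in> I" and z: "z \<in> space M" "d (F z) s < inverse (real (Suc n))" by blast
    then have s: "s \<in> S" "\<And>y. y \<in> P \<Longrightarrow> d s y < inverse (real (Suc n)) \<Longrightarrow> y \<in> U" by (auto simp: I_def)
    have "d s (F z) = d (F z) s" using d_sym s(1) S(2) F[OF z(1)] by blast
    then show "z \<in> F -` U \<inter> space M" using s(2)[OF F[OF z(1)]] z by simp
  qed
  also have "\<dots> \<in> sets M"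
  proof (rule sets.countable_UN')
    have "I \<subseteq> S \<times> UNIV" by (auto simp: I_def)
    then show "countable I" by (rule countable_subset) (simp add: S)
    show "(\<lambda>(s, n). {z \<in> space M. d (F z) s < inverse (real (Suc n))}) ` I \<subseteq> sets M"
    proof (rule image_subsetI)
      fix p assume "p \<in> I"
      obtain s n where p: "p = (s, n)" by (cases p)
      then have "s \<in> S" using \<open>p \<in> I\<close> by (simp add: I_def)
      have [measurable]: "(\<lambda>z. d (F z) s) \<in> borel_measurable M" using meas \<open>s \<in> S\<close> by blast
      show "(case p of (s, n) \<Rightarrow> {z \<in> space M. d (F z) s < inverse (real (Suc n))}) \<in> sets M"
        unfolding p by simp
    qed
  qed
  finally show "F -` U \<inter> space M \<in> sets M" .
qed (rule F)

text \<open>The map sends \<open>x\<close> to the first point, in a well-ordering, at distance less than \<open>\<epsilon>\<close>. Let \<open>C n\<close> consist of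
  the \<open>x\<close> with index in \<open>A\<close> whose ball of radius \<open>1 / (n + 1)\<close> stays within \<open>\<epsilon>\<close> of this index. Two points of \<open>C n\<close>
  with different indices cannot be closer than \<open>1 / (n + 1)\<close>, since the later one would then belong to the
  ball of the earlier index. So near any given point the index is constant on \<open>C n\<close>, which makes
  \<open>C n\<close> closed for every set \<open>A\<close> of indices, however large. The preimage of \<open>A\<close> is the union of the \<open>C n\<close>.\<close>
lemma borel_discrete_approximation:
  assumes \<epsilon>: "0 < \<epsilon>"
  obtains idx where "idx \<in> measurable (pms_borel E) (count_space P)" "\<And>x. x \<in> P \<Longrightarrow> d x (idx x) < \<epsilon>"
proof -
  obtain r :: "'e rel" where r: "well_order_on UNIV r" using well_order_on by blast
  then have wf: "wf (r - Id)" and tot: "total r"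
    by (auto simp: well_order_on_def linear_order_on_def)
  define prec where "prec = (\<lambda>a b. (a, b) \<in> r - Id)"
  have prec_total: "prec a b \<or> prec b a \<or> a = b" for a b
    using tot unfolding prec_def total_on_def by blast
  have "\<exists>a. (a \<in> P \<and> d x a < \<epsilon>) \<and> (\<forall>b\<in>P. prec b a \<longrightarrow> \<epsilon> \<le> d x b)" if "x \<in> P" for x
  proof -
    have "x \<in> {a \<in> P. d x a < \<epsilon>}" using that \<epsilon> by simp
    then obtain a where "a \<in> {a \<in> P. d x a < \<epsilon>}"
      "\<And>b. (b, a) \<in> r - Id \<Longrightarrow> b \<notin> {a \<in> P. d x a < \<epsilon>}"
      by (rule wfE_min[OF wf]) blast
    then show ?thesis by (intro exI[of _ a]) (force simp: prec_def)
  qed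
  then obtain idx where idx: "\<And>x. x \<in> P \<Longrightarrow> idx x \<in> P" "\<And>x. x \<in> P \<Longrightarrow> d x (idx x) < \<epsilon>"
    and least: "\<And>x b. x \<in> P \<Longrightarrow> b \<in> P \<Longrightarrow> prec b (idx x) \<Longrightarrow> \<epsilon> \<le> d x b"
    by metis
  have "idx \<in> measurable (pms_borel E) (count_space P)"
  proof (rule measurableI)
    fix A assume "A \<in> sets (count_space P)"
    define C where "C = (\<lambda>n::nat. {x \<in> P. idx x \<in> A \<and>
      (\<forall>y\<in>P. d x y < inverse (real (Suc n)) \<longrightarrow> d y (idx x) < \<epsilon>)})"
    have "pms_open E (P - C n)" for n
      unfolding pms_open_def
    proof (intro conjI ballI)
      fix x assume x: "x \<in> P - C n"
      show "\<exists>r>0. \<forall>y\<in>P. d x y < r \<longrightarrow> y \<in> P - C n"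
      proof (rule ccontr)
        assume "\<not> (\<exists>r>0. \<forall>y\<in>P. d x y < r \<longrightarrow> y \<in> P - C n)"
        then have lim: "\<exists>y\<in>C n. d x y < r" if "0 < r" for r using that by blast
        define \<delta> where "\<delta> = inverse (real (Suc n)) / 2"
        have \<delta>: "0 < \<delta>" "\<delta> + \<delta> = inverse (real (Suc n))" by (simp_all add: \<delta>_def)
        \<comment> \<open>Members of \<open>C n\<close> within \<open>\<delta>\<close> of \<open>x\<close> are close to each other, so neither index can precede the other.\<close>
        have sep: "\<not> prec (idx y) (idx y')" if "y \<in> C n" "y' \<in> C n" "d x y < \<delta>" "d x y' < \<delta>" for y y'
        proof
          assume prec: "prec (idx y) (idx y')"
          have yP: "y \<in> P" "y' \<in> P" using that by (auto simp: C_def)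
          have "d y y' < inverse (real (Suc n))"
            using d_tri[of y x y'] d_sym[of x y] x yP that(3,4) \<delta>(2) by auto
          then have "d y' (idx y) < \<epsilon>" using that(1) yP by (auto simp: C_def)
          moreover have "\<epsilon> \<le> d y' (idx y)" using prec yP idx least by blast
          ultimately show False by simp
        qed
        obtain y0 where y0: "y0 \<in> C n" "d x y0 < \<delta>" using lim \<delta>(1) by blast
        have const: "idx y = idx y0" if "y \<in> C n" "d x y < \<delta>" for y
          using sep[OF that(1) y0(1) that(2) y0(2)] sep[OF y0(1) that(1) y0(2) that(2)] prec_total
          by blast
        have near: "\<exists>y\<in>C n. d x y < r \<and> idx y = idx y0" if "0 < r" for r
          
        proof -
          obtain y where "y \<in> C n" "d x y < min r \<delta>" using lim[of "min r \<delta>"] \<delta>(1) \<open>0 < r\<close> by auto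
          then show ?thesis using const[of y] by auto
        qed
        have y0P: "y0 \<in> P" using y0 by (auto simp: C_def)
        have "d x y0 < inverse (real (Suc n))" using y0(2) \<delta> by linarith
        then have xa: "d x (idx y0) < \<epsilon>" using y0(1) x d_sym[of x y0] y0P by (auto simp: C_def)
        \<comment> \<open>An earlier ball containing \<open>x\<close> is open and would contain members of \<open>C n\<close> with index \<open>idx y0\<close>.\<close>
        have "\<not> prec (idx x) (idx y0)"
        proof
          assume prec: "prec (idx x) (idx y0)"
          obtain y where y: "y \<in> C n" "d x y < \<epsilon> - d x (idx x)" "idx y = idx y0"
            using near[of "\<epsilon> - d x (idx x)"] idx(2)[of x] x by auto
          have yP: "y \<in> P" using y by (auto simp: C_def)
          have "\<epsilon> \<le> d y (idx x)" using least[of y "idx x"] yP idx(1) x prec y(3) by auto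
          moreover have "d y (idx x) \<le> d x y + d x (idx x)"
            using d_tri[of y x "idx x"] d_sym[of x y] x yP idx(1) by auto
          ultimately show False using y(2) by simp
        qed
        moreover have "\<not> prec (idx y0) (idx x)"
          using least[of x "idx y0"] x idx(1)[OF y0P] xa by auto
        ultimately have eq: "idx x = idx y0" using prec_total by blast
        have "d w (idx x) < \<epsilon>" if w: "w \<in> P" "d x w < inverse (real (Suc n))" for w
        proof -
          obtain y where y: "y \<in> C n" "d x y < inverse (real (Suc n)) - d x w" "idx y = idx y0"
            using near[of "inverse (real (Suc n)) - d x w"] w by auto
          have yP: "y \<in> P" using y by (auto simp: C_def)
          have "d y w < inverse (real (Suc n))"
            using d_tri[of y x w] d_sym[of x y] x yP w y(2) by auto
          then show ?thesis using y(1,3) w(1) eq by (auto simp: C_def)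
        qed
        then have "x \<in> C n" using x eq y0(1) by (auto simp: C_def)
        then show False using x by simp
      qed
    qed auto
    then have "P - (P - C n) \<in> sets (pms_borel E)" for n
      using pms_open_sets sets.compl_sets[of "P - C n" "pms_borel E"] by auto
    then have C: "C n \<in> sets (pms_borel E)" for n
      by (simp add: double_diff C_def)
    have "idx -` A \<inter> P = (\<Union>n. C n)"
    proof (intro set_eqI iffI)
      fix x assume x: "x \<in> idx -` A \<inter> P"
      obtain n where n: "inverse (real (Suc n)) < \<epsilon> - d x (idx x)"
        using reals_Archimedean[of "\<epsilon> - d x (idx x)"] idx(2)[of x] x by auto
      have "d y (idx x) < \<epsilon>" if "y \<in> P" "d x y < inverse (real (Suc n))" for y
        using d_tri[of y x "idx x"] d_sym[of x y] x that idx(1) n by auto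
      then have "x \<in> C n" using x by (auto simp: C_def)
      then show "x \<in> (\<Union>n. C n)" by blast
    qed (auto simp: C_def)
    then show "idx -` A \<inter> space (pms_borel E) \<in> sets (pms_borel E)" using C by auto
  qed (simp add: idx)
  then show ?thesis using idx(2) by (rule that)
qed

end

section \<open>Spaces of integrable maps are pseudo-metric spaces\<close>

locale embedded_prob_space = prob_space M for M :: "'a measure" +
  fixes i :: "'a \<Rightarrow> 'p::{second_countable_topology, complete_space}"
  assumes emb: "borel_embedding M i"

locale integrable_maps = pseudo_metric E + embedded_prob_space M i
  for E :: "'e pms" and M :: "'a measure" and i :: "'a \<Rightarrow> 'p::{second_countable_topology, complete_space}"
begin

text \<open>Apply the discrete case to the composition with an approximation by indices, for each of the
  radii \<open>1 / (n + 1)\<close>.\<close>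
lemma ae_separable_range:
  assumes F: "F \<in> measurable M (pms_borel E)"
  obtains S where "countable S" "S \<subseteq> P" "AE z in M. \<forall>\<epsilon>>0. \<exists>s\<in>S. d (F z) s < \<epsilon>"
proof -
  have "\<exists>C. countable C \<and> C \<subseteq> P \<and> (AE z in M. \<exists>s\<in>C. d (F z) s < inverse (real (Suc n)))" for n
  proof -
    have "0 < inverse (real (Suc n))" by simp
    then obtain idx where idx: "idx \<in> measurable (pms_borel E) (count_space P)"
      "\<And>x. x \<in> P \<Longrightarrow> d x (idx x) < inverse (real (Suc n))"
      by (rule borel_discrete_approximation) blast
    have "(\<lambda>z. idx (F z)) \<in> measurable M (count_space P)" using F idx(1) by measurable
    then obtain C where C: "countable C" "C \<subseteq> P" "AE z in M. idx (F z) \<in> C"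
      by (rule ae_countable_range[OF prob_space_axioms emb])
    have "AE z in M. \<exists>s\<in>C. d (F z) s < inverse (real (Suc n))"
      using C(3) AE_space
    proof eventually_elim
      case (elim z)
      then show ?case using idx(2)[of "F z"] measurable_space[OF F, of z] by auto
    qed
    then show ?thesis using C by blast
  qed
  then have "\<exists>C. \<forall>n. countable (C n) \<and> C n \<subseteq> P \<and>
      (AE z in M. \<exists>s\<in>C n. d (F z) s < inverse (real (Suc n)))"
    by (intro choice allI)
  then obtain C where *: "\<forall>n. countable (C n) \<and> C n \<subseteq> P \<and>
      (AE z in M. \<exists>s\<in>C n. d (F z) s < inverse (real (Suc n)))" ..
  then have C: "\<And>n. countable (C n)" "\<And>n. C n \<subseteq> P"
    "\<And>n. AE z in M. \<exists>s\<in>C n. d (F z) s < inverse (real (Suc n))" by blast+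
  show ?thesis
  proof (rule that)
    show "countable (\<Union>n. C n)" "(\<Union>n. C n) \<subseteq> P" using C by auto
    have "AE z in M. \<forall>n. \<exists>s\<in>C n. d (F z) s < inverse (real (Suc n))"
      using C(3) by (simp add: AE_all_countable)
    then show "AE z in M. \<forall>\<epsilon>>0. \<exists>s\<in>(\<Union>n. C n). d (F z) s < \<epsilon>"
    proof eventually_elim
      case (elim z)
      show ?case
      proof (intro allI impI)
        fix \<epsilon> :: real assume "0 < \<epsilon>"
        then obtain n where "inverse (real (Suc n)) < \<epsilon>" using reals_Archimedean by blast
        then show "\<exists>s\<in>(\<Union>n. C n). d (F z) s < \<epsilon>" using elim by (meson UN_I UNIV_I less_trans)
      qed
    qed
  qed
qed

text \<open>The distance function of \<open>E\<close> need not be measurable for the product of the Borel algebras. Along a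
  countable set dense in the essential range of \<open>F\<close> it is an infimum of sums of two functions
  of one variable each.\<close>
lemma pdist_ae_measurable:
  assumes F: "F \<in> measurable M (pms_borel E)" and G: "G \<in> measurable M (pms_borel E)"
  obtains u where "u \<in> borel_measurable M" "AE z in M. ennreal (d (F z) (G z)) = u z"
proof -
  obtain S where S: "countable S" "S \<subseteq> P" "AE z in M. \<forall>\<epsilon>>0. \<exists>s\<in>S. d (F z) s < \<epsilon>"
    using F by (rule ae_separable_range)
  define u where "u = (\<lambda>z. INF s\<in>S. ennreal (d (F z) s + d (G z) s))"
  have "u \<in> borel_measurable M"
    unfolding u_def
  proof (rule borel_measurable_INF[OF S(1)])
    fix s assume "s \<in> S"
    then have [measurable]: "(\<lambda>x. d x s) \<in> borel_measurable (pms_borel E)"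
      using S(2) measurable_pdist by blast
    show "(\<lambda>z. ennreal (d (F z) s + d (G z) s)) \<in> borel_measurable M"
      using F G by measurable
  qed
  moreover have "AE z in M. ennreal (d (F z) (G z)) = u z"
    using S(3) AE_space
  proof eventually_elim
    case (elim z)
    have FG: "F z \<in> P" "G z \<in> P" using elim(2) measurable_space[OF F] measurable_space[OF G] by auto
    show ?case
      unfolding u_def
    proof (rule antisym)
      show "ennreal (d (F z) (G z)) \<le> (INF s\<in>S. ennreal (d (F z) s + d (G z) s))"
      proof (rule INF_greatest)
        fix s assume "s \<in> S"
        then have "s \<in> P" using S(2) by blast
        then show "ennreal (d (F z) (G z)) \<le> ennreal (d (F z) s + d (G z) s)"
          using d_tri[OF FG(1) _ FG(2), of s] d_sym[OF FG(2)] by (intro ennreal_leI) auto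
      qed
      show "(INF s\<in>S. ennreal (d (F z) s + d (G z) s)) \<le> ennreal (d (F z) (G z))"
      proof (rule ennreal_le_epsilon)
        fix e :: real assume "0 < e"
        then obtain s where s: "s \<in> S" "d (F z) s < e / 2"
          using elim(1) half_gt_zero by blast
        have sP: "s \<in> P" using s S(2) by blast
        have "(INF s\<in>S. ennreal (d (F z) s + d (G z) s)) \<le> ennreal (d (F z) s + d (G z) s)"
          using s(1) by (rule INF_lower)
        also have "\<dots> \<le> ennreal (d (F z) (G z) + e)"
          using d_tri[OF FG(2,1) sP] d_sym[OF FG] s(2) by (intro ennreal_leI) linarith
        also have "\<dots> = ennreal (d (F z) (G z)) + ennreal e"
          using FG \<open>0 < e\<close> by simp
        finally show "(INF s\<in>S. ennreal (d (F z) s + d (G z) s)) \<le> ennreal (d (F z) (G z)) + ennreal e" .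
      qed
    qed
  qed
  ultimately show ?thesis by (rule that)
qed

definition int_dist where "int_dist F G = (\<integral>\<^sup>+ z. ennreal (d (F z) (G z)) \<partial>M)"

text \<open>The integral of nonnegative functions is only superadditive when measurability fails, which
  is why measurable versions of the integrands are needed here.\<close>
lemma int_dist_triangle:
  assumes F: "F \<in> measurable M (pms_borel E)" and G: "G \<in> measurable M (pms_borel E)"
    and H: "H \<in> measurable M (pms_borel E)"
  shows "int_dist F H \<le> int_dist F G + int_dist G H"
proof -
  obtain u where u: "u \<in> borel_measurable M" "AE z in M. ennreal (d (F z) (G z)) = u z"
    using F G by (rule pdist_ae_measurable)
  obtain v where v: "v \<in> borel_measurable M" "AE z in M. ennreal (d (G z) (H z)) = v z"
    using G H by (rule pdist_ae_measurable)
  have "int_dist F H \<le> (\<integral>\<^sup>+ z. u z + v z \<partial>M)"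
    unfolding int_dist_def
  proof (rule nn_integral_mono_AE)
    show "AE z in M. ennreal (d (F z) (H z)) \<le> u z + v z"
      using u(2) v(2) AE_space
    proof eventually_elim
      case (elim z)
      have P: "F z \<in> P" "G z \<in> P" "H z \<in> P"
        using elim(3) measurable_space[OF F] measurable_space[OF G] measurable_space[OF H] by auto
      have "ennreal (d (F z) (H z)) \<le> ennreal (d (F z) (G z) + d (G z) (H z))"
        using d_tri P by (intro ennreal_leI) blast
      then show ?case using elim(1,2) P by simp
    qed
  qed
  also have "\<dots> = (\<integral>\<^sup>+ z. u z \<partial>M) + (\<integral>\<^sup>+ z. v z \<partial>M)"
    using u(1) v(1) by (rule nn_integral_add)
  also have "\<dots> = int_dist F G + int_dist G H"
    unfolding int_dist_def using u(2) v(2) by (intro arg_cong2[where f = "(+)"] nn_integral_cong_AE) (auto elim: eventually_mono)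
  finally show ?thesis .
qed

lemma int_dist_sym:
  assumes F: "F \<in> measurable M (pms_borel E)" and G: "G \<in> measurable M (pms_borel E)"
  shows "int_dist F G = int_dist G F"
  unfolding int_dist_def using measurable_space[OF F] measurable_space[OF G]
  by (intro nn_integral_cong) (simp add: d_sym)

lemma int_dist_eq_0_iff:
  assumes F: "F \<in> measurable M (pms_borel E)" and G: "G \<in> measurable M (pms_borel E)"
  shows "int_dist F G = 0 \<longleftrightarrow> (AE z in M. d (F z) (G z) = 0)"
proof -
  obtain u where u: "u \<in> borel_measurable M" "AE z in M. ennreal (d (F z) (G z)) = u z"
    using F G by (rule pdist_ae_measurable)
  have "int_dist F G = (\<integral>\<^sup>+ z. u z \<partial>M)" unfolding int_dist_def using u(2) by (rule nn_integral_cong_AE)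
  also have "\<dots> = 0 \<longleftrightarrow> (AE z in M. u z = 0)" using u(1) by (rule nn_integral_0_iff_AE)
  also have "\<dots> \<longleftrightarrow> (AE z in M. d (F z) (G z) = 0)"
  proof (rule eventually_subst)
    show "AE z in M. (u z = 0) = (d (F z) (G z) = 0)"
      using u(2) AE_space
    proof eventually_elim
      case (elim z)
      then have "0 \<le> d (F z) (G z)" using measurable_space[OF F, of z] measurable_space[OF G, of z] by simp
      then show ?case using elim(1) by (metis ennreal_0 ennreal_eq_0_iff order_antisym)
    qed
  qed
  finally show ?thesis .
qed

lemma pts_calL: "f \<in> pts (calL M E) \<longleftrightarrow> f \<in> measurable M (pms_borel E) \<and>
    f \<in> extensional (space M) \<and> (\<exists>c\<in>P. int_dist f (\<lambda>_. c) < \<infinity>)"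
  by (simp add: calL_def int_dist_def)

lemma pdist_calL: "pdist (calL M E) f g = enn2real (int_dist f g)"
  by (simp add: calL_def int_dist_def)

lemma int_dist_finite:
  assumes "f \<in> pts (calL M E)" "g \<in> pts (calL M E)"
  shows "int_dist f g < \<infinity>"
proof -
  obtain a where a: "a \<in> P" "int_dist f (\<lambda>_. a) < \<infinity>" using assms(1) by (auto simp: pts_calL)
  obtain b where b: "b \<in> P" "int_dist g (\<lambda>_. b) < \<infinity>" using assms(2) by (auto simp: pts_calL)
  have f: "f \<in> measurable M (pms_borel E)" and g: "g \<in> measurable M (pms_borel E)"
    using assms by (auto simp: pts_calL)
  have const: "(\<lambda>_. c) \<in> measurable M (pms_borel E)" if "c \<in> P" for c
    using that by simp
  have "int_dist f g \<le> int_dist f (\<lambda>_. a) + (int_dist (\<lambda>_. a) (\<lambda>_. b) + int_dist (\<lambda>_. b) g)"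
    using int_dist_triangle[OF f const[OF a(1)] g] int_dist_triangle[OF const[OF a(1)] const[OF b(1)] g]
    by (meson add_left_mono order_trans)
  also have "\<dots> < \<infinity>"
    using a(2) b(2) int_dist_sym[OF g const[OF b(1)]] by (simp add: int_dist_def[of "\<lambda>_. a"] emeasure_space_1)
  finally show ?thesis .
qed

lemma ennreal_pdist_calL:
  assumes "f \<in> pts (calL M E)" "g \<in> pts (calL M E)"
  shows "ennreal (pdist (calL M E) f g) = int_dist f g"
  using int_dist_finite[OF assms] by (simp add: pdist_calL less_top)

lemma pseudo_metric_space_calL: "pseudo_metric_space (calL M E)"
  unfolding pseudo_metric_space_def
proof (intro conjI ballI)
  fix f assume f: "f \<in> pts (calL M E)"
  then have fm: "f \<in> measurable M (pms_borel E)" by (simp add: pts_calL)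
  have "int_dist f f = 0"
    using measurable_space[OF fm] by (subst int_dist_eq_0_iff[OF fm fm]) (simp add: AE_I2)
  then show "pdist (calL M E) f f = 0" by (simp add: pdist_calL)
  fix g assume g: "g \<in> pts (calL M E)"
  show "0 \<le> pdist (calL M E) f g" by (simp add: pdist_calL)
  show "pdist (calL M E) f g = pdist (calL M E) g f"
    using f g int_dist_sym by (simp add: pdist_calL pts_calL)
  fix h assume h: "h \<in> pts (calL M E)"
  have "ennreal (pdist (calL M E) f h) \<le> ennreal (pdist (calL M E) f g) + ennreal (pdist (calL M E) g h)"
    unfolding ennreal_pdist_calL[OF f h] ennreal_pdist_calL[OF f g] ennreal_pdist_calL[OF g h]
    using f g h by (intro int_dist_triangle) (simp_all add: pts_calL)
  also have "\<dots> = ennreal (pdist (calL M E) f g + pdist (calL M E) g h)"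
    by (rule ennreal_plus[symmetric]) (simp_all add: pdist_calL)
  finally show "pdist (calL M E) f h \<le> pdist (calL M E) f g + pdist (calL M E) g h"
    by (subst (asm) ennreal_le_iff) (simp_all add: pdist_calL)
qed

lemma pdist_calL_eq_0_iff:
  assumes "f \<in> pts (calL M E)" "g \<in> pts (calL M E)"
  shows "pdist (calL M E) f g = 0 \<longleftrightarrow> (AE z in M. d (f z) (g z) = 0)"
proof -
  have "pdist (calL M E) f g = 0 \<longleftrightarrow> int_dist f g = 0"
    using int_dist_finite[OF assms] by (auto simp: pdist_calL enn2real_eq_0_iff)
  then show ?thesis using assms int_dist_eq_0_iff by (simp add: pts_calL)
qed

end

section \<open>Associated metric spaces and induced maps\<close>

context pseudo_metric
begin

lemma pms_class_eq: "x \<in> P \<Longrightarrow> pms_class E x = {y \<in> P. d x y = 0}"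
  by (auto simp: pms_class_def zero_rel_def)

lemma d_zero_trans: "x \<in> P \<Longrightarrow> y \<in> P \<Longrightarrow> z \<in> P \<Longrightarrow> d x y = 0 \<Longrightarrow> d x z = d y z"
  using d_tri[of x y z] d_tri[of y x z] d_sym[of x y] by simp

lemma pts_quotient: "pts (metric_quotient E) = pms_class E ` P"
  by (auto simp: metric_quotient_def quotient_def pms_class_def)

lemma pdist_quotient:
  assumes "x \<in> P" "y \<in> P"
  shows "pdist (metric_quotient E) (pms_class E x) (pms_class E y) = d x y"
proof -
  have const: "d x' y' = d x y" if "x' \<in> pms_class E x" "y' \<in> pms_class E y" for x' y'
    using that assms d_zero_trans[of x x' y'] d_zero_trans[of y y' x] d_sym[of x y] d_sym[of x y']
    by (simp add: pms_class_eq)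
  have ne: "x \<in> pms_class E x" "y \<in> pms_class E y" using assms by (auto simp: pms_class_eq)
  have "(THE r. \<forall>a\<in>pms_class E x. \<forall>b\<in>pms_class E y. d a b = r) = d x y"
  proof (rule the_equality)
    fix r assume r: "\<forall>a\<in>pms_class E x. \<forall>b\<in>pms_class E y. d a b = r"
    show "r = d x y" using r[rule_format, OF ne] by simp
  qed (use const in blast)
  then show ?thesis by (simp add: metric_quotient_def)
qed

lemma pms_class_eq_iff:
  assumes "x \<in> P" "y \<in> P"
  shows "pms_class E x = pms_class E y \<longleftrightarrow> d x y = 0"
proof
  assume eq: "pms_class E x = pms_class E y"
  have "y \<in> pms_class E x" unfolding eq using assms by (simp add: pms_class_eq)
  then show "d x y = 0" using assms by (simp add: pms_class_eq)
next
  assume "d x y = 0"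
  then show "pms_class E x = pms_class E y"
    using d_zero_trans[OF assms] assms by (auto simp: pms_class_eq)
qed

lemma pseudo_metric_space_quotient: "pseudo_metric_space (metric_quotient E)"
  unfolding pseudo_metric_space_def pts_quotient
  using d_sym d_tri by (auto simp: pdist_quotient)

lemma measurable_pms_class:
  "pms_class E \<in> measurable (pms_borel E) (pms_borel (metric_quotient E))"
  by (rule measurable_pms_borel_lipschitz) (auto simp: pts_quotient pdist_quotient)

lemma quotient_map_of_class:
  assumes \<tau>: "\<And>x. x \<in> P \<Longrightarrow> \<tau> x \<in> P" and x: "x \<in> P"
    and iso: "\<And>x y. x \<in> P \<Longrightarrow> y \<in> P \<Longrightarrow> d x y = 0 \<Longrightarrow> d (\<tau> x) (\<tau> y) = 0"
  shows "quotient_map_of E \<tau> (pms_class E x) = pms_class E (\<tau> x)"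
proof -
  have "pms_class E (\<tau> y) = pms_class E (\<tau> x)" if "y \<in> pms_class E x" for y
  proof -
    have "y \<in> P" "d y x = 0" using that x d_sym[of x y] by (auto simp: pms_class_eq)
    then show ?thesis using x \<tau> iso[of y x] by (subst pms_class_eq_iff) auto
  qed
  moreover have "x \<in> pms_class E x" using x by (simp add: pms_class_eq)
  ultimately show ?thesis unfolding quotient_map_of_def by blast
qed

end

text \<open>Points at distance zero are identified in the quotients. This makes \<open>J\<close> injective, and it makes
  \<open>J\<close> surjective although only points at distance zero from the given ones are attained.\<close>
lemma induced_bijective_isometry:
  assumes E: "pseudo_metric_space E" and F: "pseudo_metric_space F"
    and J: "\<And>x. x \<in> pts E \<Longrightarrow> J x \<in> pts F"
    and iso: "\<And>x y. x \<in> pts E \<Longrightarrow> y \<in> pts E \<Longrightarrow> pdist F (J x) (J y) = pdist E x y"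
    and onto: "\<And>y. y \<in> pts F \<Longrightarrow> \<exists>x\<in>pts E. pdist F (J x) y = 0"
  shows "\<exists>\<Psi>. bijective_isometry (metric_quotient E) (metric_quotient F) \<Psi> \<and>
    (\<forall>x\<in>pts E. \<Psi> (pms_class E x) = pms_class F (J x))"
proof -
  interpret E: pseudo_metric E by unfold_locales fact
  interpret F: pseudo_metric F by unfold_locales fact
  define \<Psi> where "\<Psi> = (\<lambda>C. pms_class F (J (SOME x. x \<in> C)))"
  have \<Psi>: "\<Psi> (pms_class E x) = pms_class F (J x)" if x: "x \<in> pts E" for x
  proof -
    have "(SOME y. y \<in> pms_class E x) \<in> pms_class E x"
      by (rule someI[of _ x]) (simp add: E.pms_class_eq x)
    then have "(SOME y. y \<in> pms_class E x) \<in> pts E" "pdist E x (SOME y. y \<in> pms_class E x) = 0"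
      by (simp_all add: E.pms_class_eq x)
    then show ?thesis
      unfolding \<Psi>_def using x by (subst F.pms_class_eq_iff) (auto simp: J iso E.d_sym)
  qed
  have "bij_betw \<Psi> (pms_class E ` pts E) (pms_class F ` pts F)"
    unfolding bij_betw_def
  proof
    show "inj_on \<Psi> (pms_class E ` pts E)"
      by (auto simp: inj_on_def \<Psi> E.pms_class_eq_iff F.pms_class_eq_iff J iso)
    show "\<Psi> ` pms_class E ` pts E = pms_class F ` pts F"
    proof (intro set_eqI iffI)
      fix C assume "C \<in> pms_class F ` pts F"
      then obtain y where y: "y \<in> pts F" "C = pms_class F y" by blast
      obtain x where x: "x \<in> pts E" "pdist F (J x) y = 0" using onto y by blast
      then have "C = \<Psi> (pms_class E x)" using y by (simp add: \<Psi> F.pms_class_eq_iff J F.d_sym)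
      then show "C \<in> \<Psi> ` pms_class E ` pts E" using x by blast
    qed (auto simp: \<Psi> J)
  qed
  moreover have "pdist (metric_quotient F) (\<Psi> A) (\<Psi> B) = pdist (metric_quotient E) A B"
    if "A \<in> pms_class E ` pts E" "B \<in> pms_class E ` pts E" for A B
    using that by (auto simp: \<Psi> J iso E.pdist_quotient F.pdist_quotient)
  ultimately have "bijective_isometry (metric_quotient E) (metric_quotient F) \<Psi>"
    by (simp add: bijective_isometry_def E.pts_quotient F.pts_quotient)
  then show ?thesis using \<Psi> by blast
qed

context integrable_maps
begin

interpretation L: pseudo_metric "calL M E"
  by unfold_locales (rule pseudo_metric_space_calL)

lemma int_dist_postcompose:
  assumes iso: "\<forall>x\<in>P. \<forall>y\<in>P. d (\<tau> x) (\<tau> y) = d x y"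
    and f: "f \<in> pts (calL M E)" and g: "g \<in> pts (calL M E)"
  shows "int_dist (\<lambda>z\<in>space M. \<tau> (f z)) (\<lambda>z\<in>space M. \<tau> (g z)) = int_dist f g"
proof -
  have "f z \<in> P" "g z \<in> P" if "z \<in> space M" for z
    using f g measurable_space[OF _ that, of f "pms_borel E"] measurable_space[OF _ that, of g "pms_borel E"]
    by (auto simp: pts_calL)
  then show ?thesis unfolding int_dist_def using iso by (intro nn_integral_cong) simp
qed

lemma postcompose_pts:
  assumes \<tau>: "\<tau> \<in> P \<rightarrow> P" and iso: "\<forall>x\<in>P. \<forall>y\<in>P. d (\<tau> x) (\<tau> y) = d x y"
    and f: "f \<in> pts (calL M E)"
  shows "(\<lambda>z\<in>space M. \<tau> (f z)) \<in> pts (calL M E)"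
proof -
  have "\<tau> \<in> measurable (pms_borel E) (pms_borel E)"
    by (rule measurable_pms_borel_lipschitz) (use \<tau> iso in auto)
  moreover have fm: "f \<in> measurable M (pms_borel E)" using f by (simp add: pts_calL)
  ultimately have "(\<lambda>z. \<tau> (f z)) \<in> measurable M (pms_borel E)" by measurable
  then have m: "(\<lambda>z\<in>space M. \<tau> (f z)) \<in> measurable M (pms_borel E)"
    by (subst measurable_cong[where g = "\<lambda>z. \<tau> (f z)"]) simp_all
  obtain c where c: "c \<in> P" "int_dist f (\<lambda>_. c) < \<infinity>" using f by (auto simp: pts_calL)
  have "int_dist (\<lambda>z\<in>space M. \<tau> (f z)) (\<lambda>_. \<tau> c) = int_dist f (\<lambda>_. c)"
    unfolding int_dist_def using c(1) measurable_space[OF fm] by (intro nn_integral_cong) (simp add: iso)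
  then show ?thesis using m funcset_mem[OF \<tau> c(1)] c(2)
    unfolding pts_calL by (auto intro!: bexI[of _ "\<tau> c"])
qed

lemma metL_act_class:
  assumes \<tau>: "\<tau> \<in> P \<rightarrow> P" and iso: "\<forall>x\<in>P. \<forall>y\<in>P. d (\<tau> x) (\<tau> y) = d x y"
    and f: "f \<in> pts (calL M E)"
  shows "metL_act M E \<tau> (pms_class (calL M E) f) = pms_class (calL M E) (\<lambda>z\<in>space M. \<tau> (f z))"
  unfolding metL_act_def
proof (rule L.quotient_map_of_class)
  show "(\<lambda>z\<in>space M. \<tau> (f z)) \<in> pts (calL M E)" if "f \<in> pts (calL M E)" for f
    using \<tau> iso that by (rule postcompose_pts)
  fix f g assume fg: "f \<in> pts (calL M E)" "g \<in> pts (calL M E)" "pdist (calL M E) f g = 0"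
  have "int_dist (\<lambda>z\<in>space M. \<tau> (f z)) (\<lambda>z\<in>space M. \<tau> (g z)) = int_dist f g"
    using iso fg(1,2) by (rule int_dist_postcompose)
  then show "pdist (calL M E) (\<lambda>z\<in>space M. \<tau> (f z)) (\<lambda>z\<in>space M. \<tau> (g z)) = 0"
    using fg by (simp add: pdist_calL)
qed (rule f)

text \<open>An isometry of \<open>E\<close> acts isometrically on classes, so that the construction can be iterated: the
  action on \<open>metL\<close> of one space is again the kind of map that acts on maps into this space.\<close>
lemma metL_act_isometry:
  assumes \<tau>: "\<tau> \<in> P \<rightarrow> P" and iso: "\<forall>x\<in>P. \<forall>y\<in>P. d (\<tau> x) (\<tau> y) = d x y"
    and C: "C \<in> pts (metL M E)" and C': "C' \<in> pts (metL M E)"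
  shows "metL_act M E \<tau> C \<in> pts (metL M E)"
    and "pdist (metL M E) (metL_act M E \<tau> C) (metL_act M E \<tau> C') = pdist (metL M E) C C'"
proof -
  obtain f g where f: "f \<in> pts (calL M E)" "C = pms_class (calL M E) f"
    and g: "g \<in> pts (calL M E)" "C' = pms_class (calL M E) g"
    using C C' by (auto simp: metL_def L.pts_quotient)
  note act = metL_act_class[OF \<tau> iso]
  have tf: "(\<lambda>z\<in>space M. \<tau> (f z)) \<in> pts (calL M E)" and tg: "(\<lambda>z\<in>space M. \<tau> (g z)) \<in> pts (calL M E)"
    using postcompose_pts[OF \<tau> iso] f(1) g(1) by auto
  show "metL_act M E \<tau> C \<in> pts (metL M E)"
    using tf f act[OF f(1)] by (simp add: metL_def L.pts_quotient)
  have "int_dist (\<lambda>z\<in>space M. \<tau> (f z)) (\<lambda>z\<in>space M. \<tau> (g z)) = int_dist f g"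
    using iso f(1) g(1) by (rule int_dist_postcompose)
  then show "pdist (metL M E) (metL_act M E \<tau> C) (metL_act M E \<tau> C') = pdist (metL M E) C C'"
    using f g tf tg by (simp add: metL_def act L.pdist_quotient pdist_calL)
qed

end

section \<open>Separability of the sections of a measurable set\<close>

text \<open>The error made by cutting off a countable union and by replacing each of the remaining pieces:
  \<open>m\<close> bounds the tail by \<open>\<epsilon> / 2\<close>, and \<open>\<delta>\<close> is small enough for \<open>m\<close> further errors.\<close>
lemma (in finite_measure) small_union_bound:
  assumes A: "\<And>n::nat. A n \<in> sets M" and \<epsilon>: "0 < \<epsilon>"
  obtains m \<delta> where "0 < \<delta>"
    "\<And>S. (\<And>n. n < m \<Longrightarrow> S n \<in> sets M \<and> measure M (S n) < \<delta>) \<Longrightarrow>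
      measure M (((\<Union>n. A n) - (\<Union>n<m. A n)) \<union> (\<Union>n<m. S n)) < \<epsilon>"
proof -
  have "(\<lambda>m. measure M (\<Union>n<m. A n)) \<longlonglongrightarrow> measure M (\<Union>m. \<Union>n<m. A n)"
    using A by (intro finite_Lim_measure_incseq) (auto simp: incseq_def, force)
  also have "(\<Union>m. \<Union>n<m. A n) = (\<Union>n. A n)" by auto
  finally have "\<forall>\<^sub>F m in sequentially. measure M (\<Union>n. A n) - \<epsilon>/2 < measure M (\<Union>n<m. A n)"
    by (rule order_tendstoD(1)) (use \<epsilon> in simp)
  then obtain m where m: "measure M (\<Union>n. A n) - \<epsilon>/2 < measure M (\<Union>n<m. A n)"
    using eventually_happens' sequentially_bot by blast
  have tail: "measure M ((\<Union>n. A n) - (\<Union>n<m. A n)) < \<epsilon>/2"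
    using m A by (subst finite_measure_Diff) auto
  define \<delta> where "\<delta> = \<epsilon> / (2 * (real m + 1))"
  have \<delta>: "0 < \<delta>" "real m * \<delta> \<le> \<epsilon>/2" using \<epsilon> by (auto simp: \<delta>_def field_simps)
  show ?thesis
  proof (rule that[OF \<delta>(1)])
    fix S assume S: "\<And>n. n < m \<Longrightarrow> S n \<in> sets M \<and> measure M (S n) < \<delta>"
    have "measure M (\<Union>n<m. S n) \<le> (\<Sum>n<m. measure M (S n))"
      using S by (intro finite_measure_subadditive_finite) auto
    also have "\<dots> \<le> (\<Sum>n<m. \<delta>)" using S by (intro sum_mono) (auto intro: less_imp_le)
    also have "\<dots> \<le> \<epsilon>/2" using \<delta> by simp
    finally have "measure M (\<Union>n<m. S n) \<le> \<epsilon>/2" .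
    moreover have "measure M (((\<Union>n. A n) - (\<Union>n<m. A n)) \<union> (\<Union>n<m. S n)) \<le>
      measure M ((\<Union>n. A n) - (\<Union>n<m. A n)) + measure M (\<Union>n<m. S n)"
      using A S by (intro measure_Un_le sets.Diff sets.countable_UN sets.finite_UN) auto
    ultimately show "measure M (((\<Union>n. A n) - (\<Union>n<m. A n)) \<union> (\<Union>n<m. S n)) < \<epsilon>"
      using tail by linarith
  qed
qed

text \<open>Proved by induction over the product \<open>\<sigma>\<close>-algebra. A rectangle has two sections only, complements
  preserve the property, and for a countable union finite unions of the approximating sets suffice.\<close>
lemma (in finite_measure) separable_sections:
  assumes "A \<in> sets (X \<Otimes>\<^sub>M M)"
  obtains N where "countable N" "N \<subseteq> sets M"
    "\<And>x \<epsilon>. x \<in> space X \<Longrightarrow> 0 < \<epsilon> \<Longrightarrow>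
       \<exists>B\<in>N. measure M ((Pair x -` A - B) \<union> (B - Pair x -` A)) < \<epsilon>"
proof -
  define sep where "sep = (\<lambda>A. \<exists>N. countable N \<and> N \<subseteq> sets M \<and>
    (\<forall>x\<in>space X. \<forall>\<epsilon>>0. \<exists>B\<in>N. measure M ((Pair x -` A - B) \<union> (B - Pair x -` A)) < \<epsilon>))"
  have "A \<in> sigma_sets (space X \<times> space M) {a \<times> b |a b. a \<in> sets X \<and> b \<in> sets M}"
    using assms by (simp add: sets_pair_measure)
  then have "sep A"
  proof induction
    case (Basic A)
    then obtain a b where "A = a \<times> b" "b \<in> sets M" by blast
    then show ?case unfolding sep_def
      by (intro exI[of _ "{{}, b}"]) (auto split: if_splits)
  next
    case Empty
    then show ?case unfolding sep_def by (intro exI[of _ "{{}}"]) auto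
  next
    case (Compl A)
    then obtain N where N: "countable N" "N \<subseteq> sets M"
      "\<And>x \<epsilon>. x \<in> space X \<Longrightarrow> 0 < \<epsilon> \<Longrightarrow> \<exists>B\<in>N. measure M ((Pair x -` A - B) \<union> (B - Pair x -` A)) < \<epsilon>"
      unfolding sep_def by blast
    have sub: "A \<subseteq> space X \<times> space M"
      using pair_measure_closed Compl.hyps by (rule sigma_sets_into_sp)
    have eq: "(Pair x -` (space X \<times> space M - A) - (space M - B)) \<union> ((space M - B) - Pair x -` (space X \<times> space M - A))
      = (Pair x -` A - B) \<union> (B - Pair x -` A)" if "x \<in> space X" "B \<in> N" for x B
    proof -
      have "B \<subseteq> space M" using that(2) N(2) sets.sets_into_space by blast
      then show ?thesis using that(1) sub by blast
    qed
    show ?case unfolding sep_def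
    proof (intro exI[of _ "(\<lambda>B. space M - B) ` N"] conjI ballI allI impI)
      fix x and \<epsilon> :: real assume "x \<in> space X" "0 < \<epsilon>"
      then obtain B where "B \<in> N" "measure M ((Pair x -` A - B) \<union> (B - Pair x -` A)) < \<epsilon>" using N(3) by blast
      then show "\<exists>B\<in>(\<lambda>B. space M - B) ` N.
        measure M ((Pair x -` (space X \<times> space M - A) - B) \<union> (B - Pair x -` (space X \<times> space M - A))) < \<epsilon>"
        using eq \<open>x \<in> space X\<close> by (intro bexI[of _ "space M - B"]) auto
    qed (use N in auto)
  next
    case (Union A)
    then have A: "Pair x -` A n \<in> sets M" for n x
      by (intro sets_Pair1) (simp add: sets_pair_measure)
    have "\<exists>N. \<forall>n. countable (N n) \<and> N n \<subseteq> sets M \<and>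
      (\<forall>x\<in>space X. \<forall>\<epsilon>>0. \<exists>B\<in>N n. measure M ((Pair x -` A n - B) \<union> (B - Pair x -` A n)) < \<epsilon>)"
      using Union.IH unfolding sep_def by (intro choice allI)
    then obtain N where N': "\<forall>n. countable (N n) \<and> N n \<subseteq> sets M \<and>
      (\<forall>x\<in>space X. \<forall>\<epsilon>>0. \<exists>B\<in>N n. measure M ((Pair x -` A n - B) \<union> (B - Pair x -` A n)) < \<epsilon>)" ..
    then have N: "\<And>n. countable (N n)" "\<And>n. N n \<subseteq> sets M"
      "\<And>n x \<epsilon>. x \<in> space X \<Longrightarrow> 0 < \<epsilon> \<Longrightarrow> \<exists>B\<in>N n. measure M ((Pair x -` A n - B) \<union> (B - Pair x -` A n)) < \<epsilon>"
      by blast+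
    then have "(\<Union>n. N n) \<subseteq> sets M" by blast
    define N\<^sub>0 where "N\<^sub>0 = Union ` {F. finite F \<and> F \<subseteq> (\<Union>n. N n)}"
    show ?case unfolding sep_def
    proof (intro exI[of _ "N\<^sub>0"] conjI ballI allI impI)
      show "countable N\<^sub>0" unfolding N\<^sub>0_def
        using N(1) by (intro countable_image countable_Collect_finite_subset) auto
      show "N\<^sub>0 \<subseteq> sets M" unfolding N\<^sub>0_def using \<open>(\<Union>n. N n) \<subseteq> sets M\<close>
        by (intro image_subsetI sets.finite_Union) auto
      fix x and \<epsilon> :: real assume x: "x \<in> space X" and \<epsilon>: "0 < \<epsilon>"
      obtain m \<delta> where \<delta>: "0 < \<delta>" and m: "\<And>S. (\<And>n. n < m \<Longrightarrow> S n \<in> sets M \<and> measure M (S n) < \<delta>) \<Longrightarrow>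
          measure M (((\<Union>n. Pair x -` A n) - (\<Union>n<m. Pair x -` A n)) \<union> (\<Union>n<m. S n)) < \<epsilon>"
        using small_union_bound[of "\<lambda>n. Pair x -` A n", OF A \<epsilon>] by metis
      have "\<exists>B. \<forall>n. B n \<in> N n \<and> measure M ((Pair x -` A n - B n) \<union> (B n - Pair x -` A n)) < \<delta>"
        using N(3)[OF x \<delta>] by (intro choice allI) blast
      then obtain B where B: "\<forall>n. B n \<in> N n \<and> measure M ((Pair x -` A n - B n) \<union> (B n - Pair x -` A n)) < \<delta>" ..
      have BM: "B n \<in> sets M" for n using B N(2) by blast
      let ?S = "\<lambda>n. (Pair x -` A n - B n) \<union> (B n - Pair x -` A n)"
      have "measure M ((Pair x -` (\<Union>n. A n) - (\<Union>n<m. B n)) \<union> ((\<Union>n<m. B n) - Pair x -` (\<Union>n. A n))) \<le>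
        measure M (((\<Union>n. Pair x -` A n) - (\<Union>n<m. Pair x -` A n)) \<union> (\<Union>n<m. ?S n))"
        using A BM by (intro finite_measure_mono sets.Un sets.Diff sets.countable_UN sets.finite_UN) auto
      also have "\<dots> < \<epsilon>" using A BM B by (intro m) auto
      finally show "\<exists>B\<in>N\<^sub>0. measure M ((Pair x -` (\<Union>n. A n) - B) \<union> (B - Pair x -` (\<Union>n. A n))) < \<epsilon>"
        unfolding N\<^sub>0_def using B by (intro bexI[of _ "\<Union>n<m. B n"]) (auto intro!: imageI)
    qed
  qed
  then show ?thesis using that unfolding sep_def by blast
qed

text \<open>The first set in the list that contains the argument decides, so that arbitrary lists are
  meaningful and those with entries in a countable set form a countable family of maps.\<close>
fun step_map :: "'d \<Rightarrow> ('d \<times> 'y set) list \<Rightarrow> 'y \<Rightarrow> 'd" where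
  "step_map e [] y = e"
| "step_map e ((c, B) # l) y = (if y \<in> B then c else step_map e l y)"

lemma step_map_measurable:
  assumes "e \<in> D" "set l \<subseteq> D \<times> sets M"
  shows "step_map e l \<in> measurable M (count_space D)"
  using assms(2)
proof (induction l)
  case (Cons p l)
  obtain c B where p: "p = (c, B)" by (cases p)
  have "step_map e l \<in> measurable M (count_space D)" "B \<in> sets M" "c \<in> D"
    using Cons p by auto
  then show ?case unfolding p step_map.simps by (intro measurable_If_set) auto
next
  case Nil
  have "step_map e [] = (\<lambda>_. e)" by auto
  then show ?case using assms(1) by simp
qed

lemma step_map_eqI:
  assumes "\<exists>p\<in>set l. y \<in> snd p" "\<And>p. p \<in> set l \<Longrightarrow> y \<in> snd p \<Longrightarrow> fst p = c"
  shows "step_map e l y = c"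
  using assms
proof (induction l)
  case (Cons p l)
  show ?case
  proof (cases "y \<in> snd p")
    case True
    then show ?thesis using Cons.prems(2)[of p] by (cases p) auto
  next
    case False
    then have "step_map e l y = c" using Cons.prems by (intro Cons.IH) auto
    then show ?thesis using False by (cases p) auto
  qed
qed simp

text \<open>A countably valued map consists of countably many measurable sets, so the step maps built from
  countable families of sets approximating their sections form a countable dense set.\<close>
lemma (in finite_measure) separable_curried_map:
  assumes f: "f \<in> measurable (X \<Otimes>\<^sub>M M) (count_space D)" and e: "e \<in> D"
    and C: "countable C" "C \<subseteq> D" "f ` space (X \<Otimes>\<^sub>M M) \<subseteq> C"
  obtains S where "countable S" "S \<subseteq> measurable M (count_space D)"
    "\<And>x \<epsilon>. x \<in> space X \<Longrightarrow> 0 < \<epsilon> \<Longrightarrow> \<exists>s\<in>S. measure M {y \<in> space M. f (x, y) \<noteq> s y} < \<epsilon>"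
proof -
  define c where "c = from_nat_into (insert e C)"
  have c: "c n \<in> D" for n unfolding c_def using from_nat_into[of "insert e C" n] C(2) e by auto
  have c_surj: "\<exists>n. c n = d" if "d \<in> C" for d
    unfolding c_def using from_nat_into_surj[of "insert e C" d] that C(1) by auto
  define A where "A = (\<lambda>n. f -` {c n} \<inter> space (X \<Otimes>\<^sub>M M))"
  have A[measurable]: "A n \<in> sets (X \<Otimes>\<^sub>M M)" for n
    unfolding A_def using f c by (auto intro: measurable_sets)
  have Ax: "y \<in> Pair x -` A n \<longleftrightarrow> y \<in> space M \<and> f (x, y) = c n" if "x \<in> space X" for x y n
    using that by (auto simp: A_def space_pair_measure)
  have AxM: "Pair x -` A n \<in> sets M" for x n by (rule sets_Pair1) (rule A)
  have "\<exists>N. \<forall>n. countable (N n) \<and> N n \<subseteq> sets M \<and>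
      (\<forall>x\<in>space X. \<forall>\<epsilon>>0. \<exists>B\<in>N n. measure M ((Pair x -` A n - B) \<union> (B - Pair x -` A n)) < \<epsilon>)"
    by (intro choice allI) (rule separable_sections[OF A], blast)
  then obtain N where N': "\<forall>n. countable (N n) \<and> N n \<subseteq> sets M \<and>
      (\<forall>x\<in>space X. \<forall>\<epsilon>>0. \<exists>B\<in>N n. measure M ((Pair x -` A n - B) \<union> (B - Pair x -` A n)) < \<epsilon>)" ..
  then have N: "\<And>n. countable (N n)" "\<And>n. N n \<subseteq> sets M"
      "\<And>n x \<epsilon>. x \<in> space X \<Longrightarrow> 0 < \<epsilon> \<Longrightarrow> \<exists>B\<in>N n. measure M ((Pair x -` A n - B) \<union> (B - Pair x -` A n)) < \<epsilon>"
    by blast+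
  define L where "L = lists (range c \<times> (\<Union>n. N n))"
  have L: "set l \<subseteq> D \<times> sets M" if "l \<in> L" for l using that c N(2) by (force simp: L_def)
  show ?thesis
  proof (rule that[of "step_map e ` L"])
    show "countable (step_map e ` L)"
      unfolding L_def using N(1) by (intro countable_image countable_lists countable_SIGMA) auto
    show "step_map e ` L \<subseteq> measurable M (count_space D)"
      using step_map_measurable[OF e] L by blast
    fix x and \<epsilon> :: real assume x: "x \<in> space X" and \<epsilon>: "0 < \<epsilon>"
    obtain m \<delta> where \<delta>: "0 < \<delta>" and m: "\<And>S. (\<And>n. n < m \<Longrightarrow> S n \<in> sets M \<and> measure M (S n) < \<delta>) \<Longrightarrow>
        measure M (((\<Union>n. Pair x -` A n) - (\<Union>n<m. Pair x -` A n)) \<union> (\<Union>n<m. S n)) < \<epsilon>"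
      using small_union_bound[of "\<lambda>n. Pair x -` A n", OF AxM \<epsilon>] by metis
    have "\<exists>B. \<forall>n. B n \<in> N n \<and> measure M ((Pair x -` A n - B n) \<union> (B n - Pair x -` A n)) < \<delta>"
      using N(3)[OF x \<delta>] by (intro choice allI) blast
    then obtain B where B: "\<forall>n. B n \<in> N n \<and> measure M ((Pair x -` A n - B n) \<union> (B n - Pair x -` A n)) < \<delta>" ..
    have BM: "B n \<in> sets M" for n using B N(2) by blast
    let ?S = "\<lambda>n. (Pair x -` A n - B n) \<union> (B n - Pair x -` A n)"
    define l where "l = map (\<lambda>n. (c n, B n)) [0..<m]"
    have "l \<in> L" using B by (auto simp: l_def L_def) blast
    \<comment> \<open>Outside of the right-hand side the sets \<open>B n\<close>, \<open>n < m\<close>, agree with the fibres of \<open>f (x, \<cdot>)\<close>, one of which contains \<open>y\<close>.\<close>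
    have "{y \<in> space M. f (x, y) \<noteq> step_map e l y} \<subseteq>
      ((\<Union>n. Pair x -` A n) - (\<Union>n<m. Pair x -` A n)) \<union> (\<Union>n<m. ?S n)" (is "?L \<subseteq> ?R")
    proof
      fix y assume y: "y \<in> ?L"
      show "y \<in> ?R"
      proof (rule ccontr)
        assume ny: "y \<notin> ?R"
        have "f (x, y) \<in> C" using y x C(3) by (auto simp: space_pair_measure)
        then obtain n where "c n = f (x, y)" using c_surj by blast
        then have "y \<in> Pair x -` A n" using y Ax[OF x, of y n] by simp
        then have "y \<in> (\<Union>n. Pair x -` A n)" by blast
        then obtain k where k: "k < m" "y \<in> Pair x -` A k" using ny by auto
        have AB: "y \<in> Pair x -` A n \<longleftrightarrow> y \<in> B n" if "n < m" for n using ny that by auto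
        have "step_map e l y = f (x, y)"
        proof (rule step_map_eqI)
          show "\<exists>p\<in>set l. y \<in> snd p" using k AB by (auto simp: l_def)
          fix p assume "p \<in> set l" "y \<in> snd p"
          then obtain n where "n < m" "p = (c n, B n)" "y \<in> B n" by (auto simp: l_def)
          then show "fst p = f (x, y)" using AB[of n] Ax[OF x, of y n] by auto
        qed
        then show False using y by simp
      qed
    qed
    then have "measure M ?L \<le> measure M ?R"
      using AxM BM by (intro finite_measure_mono sets.Un sets.Diff sets.countable_UN sets.finite_UN) auto
    also have "\<dots> < \<epsilon>" using AxM BM B by (intro m) auto
    finally show "\<exists>s\<in>step_map e ` L. measure M {y \<in> space M. f (x, y) \<noteq> s y} < \<epsilon>"
      using \<open>l \<in> L\<close> by blast
  qed
qed

section \<open>Maps with values in a discrete space\<close>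

lemma (in integrable_maps) pts_calL_bounded:
  assumes "\<And>x y. x \<in> P \<Longrightarrow> y \<in> P \<Longrightarrow> d x y \<le> 1" and "c \<in> P"
  shows "f \<in> pts (calL M E) \<longleftrightarrow> f \<in> measurable M (pms_borel E) \<and> f \<in> extensional (space M)"
proof -
  have "int_dist f (\<lambda>_. c) < \<infinity>" if f: "f \<in> measurable M (pms_borel E)"
  proof -
    have "int_dist f (\<lambda>_. c) \<le> (\<integral>\<^sup>+ z. 1 \<partial>M)"
      unfolding int_dist_def using assms measurable_space[OF f]
      by (intro nn_integral_mono) simp
    also have "\<dots> < \<infinity>" by (simp add: emeasure_space_1)
    finally show ?thesis .
  qed
  then show ?thesis using assms(2) by (auto simp: pts_calL)
qed

lemma (in integrable_maps) pdist_calL_bounded: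
  assumes "\<And>x y. x \<in> P \<Longrightarrow> y \<in> P \<Longrightarrow> d x y \<le> 1"
    and f: "f \<in> pts (calL M E)" and g: "g \<in> pts (calL M E)"
  shows "pdist (calL M E) f g \<le> 1"
proof -
  have fm: "f \<in> measurable M (pms_borel E)" and gm: "g \<in> measurable M (pms_borel E)"
    using f g by (auto simp: pts_calL)
  have "int_dist f g \<le> (\<integral>\<^sup>+ z. 1 \<partial>M)"
    unfolding int_dist_def using assms measurable_space[OF fm] measurable_space[OF gm]
    by (intro nn_integral_mono) simp
  then have "ennreal (pdist (calL M E) f g) \<le> ennreal 1"
    unfolding ennreal_pdist_calL[OF f g] by (simp add: emeasure_space_1)
  then show ?thesis by (subst (asm) ennreal_le_iff) auto
qed

lemma pts_discrete [simp]: "pts (discrete_pms D) = D"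
  by (simp add: discrete_pms_def)

lemma pdist_discrete [simp]: "pdist (discrete_pms D) x y = (if x = y then 0 else 1)"
  by (simp add: discrete_pms_def discrete_metric.dd_def)

lemma pseudo_metric_space_discrete: "pseudo_metric_space (discrete_pms D)"
  by (auto simp: pseudo_metric_space_def)

lemma measurable_discrete:
  "measurable M (pms_borel (discrete_pms D)) = measurable M (count_space D)"
proof (rule measurable_cong_sets)
  have "pms_open (discrete_pms D) U" if "U \<subseteq> D" for U
    using that unfolding pms_open_def by (auto intro!: exI[of _ 1])
  then have "Pow D \<subseteq> sets (pms_borel (discrete_pms D))"
    using pms_open_sets by blast
  then show "sets (pms_borel (discrete_pms D)) = sets (count_space D)"
    using sets.sets_into_space[of _ "pms_borel (discrete_pms D)"] by auto
qed simp

lemma measurable_restrict_iff: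
  "(\<lambda>z\<in>space M. f z) \<in> measurable M N \<longleftrightarrow> f \<in> measurable M N"
  by (rule measurable_cong) simp

lemma measurable_count_space_countable_subset:
  assumes "countable C" "C \<subseteq> D" "\<And>z. z \<in> space M \<Longrightarrow> f z \<in> C"
    and "\<And>c. c \<in> C \<Longrightarrow> f -` {c} \<inter> space M \<in> sets M"
  shows "f \<in> measurable M (count_space D)"
proof (rule measurable_compose[of f M "count_space C" "\<lambda>c. c" "count_space D", simplified])
  show "f \<in> measurable M (count_space C)"
    using assms by (subst measurable_count_space_eq_countable) auto
qed (use assms(2) in auto)

lemma sets_neq_countable_range:
  assumes f: "f \<in> measurable M (count_space D)" and g: "g \<in> measurable M (count_space D)"
    and C: "countable (g ` space M)"
  shows "{z \<in> space M. f z \<noteq> g z} \<in> sets M"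
proof -
  have gD: "g z \<in> D" if "z \<in> space M" for z using measurable_space[OF g that] by simp
  have "{z \<in> space M. f z \<noteq> g z} =
      space M - (\<Union>c\<in>g ` space M. (f -` {c} \<inter> space M) \<inter> (g -` {c} \<inter> space M))" by auto
  also have "\<dots> \<in> sets M"
    using C f g gD by (intro sets.Diff sets.top sets.countable_UN' sets.Int measurable_sets image_subsetI) auto
  finally show ?thesis .
qed

locale discrete_valued_maps = embedded_prob_space M i
  for M :: "'a measure" and i :: "'a \<Rightarrow> 'p::{second_countable_topology, complete_space}" +
  fixes D :: "'d set" and e :: 'd
  assumes e: "e \<in> D"
begin

sublocale integrable_maps "discrete_pms D" M i
  by unfold_locales (rule pseudo_metric_space_discrete)

lemma pts_calL_discrete:
  "f \<in> pts (calL M (discrete_pms D)) \<longleftrightarrow> f \<in> measurable M (count_space D) \<and> f \<in> extensional (space M)"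
  using pts_calL_bounded[of e f] e by (simp add: measurable_discrete)

lemma int_dist_discrete:
  assumes "{z \<in> space M. f z \<noteq> g z} \<in> sets M"
  shows "int_dist f g = emeasure M {z \<in> space M. f z \<noteq> g z}"
proof -
  have "int_dist f g = (\<integral>\<^sup>+ z. indicator {z \<in> space M. f z \<noteq> g z} z \<partial>M)"
    unfolding int_dist_def by (intro nn_integral_cong) simp
  then show ?thesis using assms by simp
qed

lemma pdist_calL_discrete:
  assumes "{z \<in> space M. f z \<noteq> g z} \<in> sets M"
  shows "pdist (calL M (discrete_pms D)) f g = measure M {z \<in> space M. f z \<noteq> g z}"
  using assms by (simp add: pdist_calL int_dist_discrete measure_def)

lemma pdist_calL_discrete_eq_0_iff:
  assumes "f \<in> pts (calL M (discrete_pms D))" "g \<in> pts (calL M (discrete_pms D))"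
  shows "pdist (calL M (discrete_pms D)) f g = 0 \<longleftrightarrow> (AE z in M. f z = g z)"
  using pdist_calL_eq_0_iff[OF assms] by simp

lemma countable_range_modification:
  assumes f: "f \<in> pts (calL M (discrete_pms D))"
  obtains f' where "f' \<in> pts (calL M (discrete_pms D))" "countable (f' ` space M)"
    "AE z in M. f' z = f z"
proof -
  have fm: "f \<in> measurable M (count_space D)" using f by (simp add: pts_calL_discrete)
  obtain C where C: "countable C" "C \<subseteq> D" "AE z in M. f z \<in> C"
    using prob_space_axioms emb fm by (rule ae_countable_range)
  define f' where "f' = (\<lambda>z\<in>space M. if f z \<in> C then f z else e)"
  have "(\<lambda>z. if f z \<in> C then f z else e) \<in> measurable M (count_space D)"
    using fm by (rule measurable_compose) (simp add: e)
  then have "f' \<in> pts (calL M (discrete_pms D))"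
    by (simp add: f'_def pts_calL_discrete measurable_restrict_iff)
  moreover have "f' ` space M \<subseteq> insert e C" by (auto simp: f'_def)
  then have "countable (f' ` space M)" by (rule countable_subset) (simp add: C(1))
  moreover have "AE z in M. f' z = f z"
    using C(3) AE_space by eventually_elim (simp add: f'_def)
  ultimately show ?thesis by (rule that)
qed

end

section \<open>Currying\<close>

locale two_factors = X: embedded_prob_space X i + Y: embedded_prob_space Y j
  for X :: "'x measure" and i :: "'x \<Rightarrow> 'p::{second_countable_topology, complete_space}"
    and Y :: "'y measure" and j :: "'y \<Rightarrow> 'q::{second_countable_topology, complete_space}" +
  fixes D :: "'d set" and e :: 'd
  assumes e: "e \<in> D"
begin

abbreviation "LXY \<equiv> calL (X \<Otimes>\<^sub>M Y) (discrete_pms D)"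
abbreviation "LY \<equiv> calL Y (discrete_pms D)"
abbreviation "QY \<equiv> metL Y (discrete_pms D)"

sublocale XY: pair_prob_space X Y ..

sublocale LXY: discrete_valued_maps "X \<Otimes>\<^sub>M Y" "\<lambda>(x, y). (i x, j y)" D e
  by unfold_locales (auto simp: e intro: borel_embedding_pair X.emb Y.emb)

sublocale LY: discrete_valued_maps Y j D e
  by unfold_locales (rule e)

sublocale XLY: integrable_maps LY X i
  by unfold_locales (rule LY.pseudo_metric_space_calL)

sublocale XQY: integrable_maps QY X i
  unfolding metL_def by unfold_locales (rule XLY.pseudo_metric_space_quotient)

lemma LY_bounded: "f \<in> pts LY \<Longrightarrow> g \<in> pts LY \<Longrightarrow> pdist LY f g \<le> 1"
  by (rule LY.pdist_calL_bounded) auto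

lemma const_LY: "(\<lambda>y\<in>space Y. e) \<in> pts LY"
  using e by (simp add: LY.pts_calL_discrete measurable_restrict_iff)

lemma pts_QY: "pts QY = pms_class LY ` pts LY"
  unfolding metL_def by (rule XLY.pts_quotient)

lemma pdist_QY: "f \<in> pts LY \<Longrightarrow> g \<in> pts LY \<Longrightarrow> pdist QY (pms_class LY f) (pms_class LY g) = pdist LY f g"
  unfolding metL_def by (rule XLY.pdist_quotient)

lemma QY_bounded: "C \<in> pts QY \<Longrightarrow> C' \<in> pts QY \<Longrightarrow> pdist QY C C' \<le> 1"
  by (auto simp: pts_QY pdist_QY LY_bounded)

lemma pts_XLY: "F \<in> pts (calL X LY) \<longleftrightarrow> F \<in> measurable X (pms_borel LY) \<and> F \<in> extensional (space X)"
  by (rule XLY.pts_calL_bounded[OF LY_bounded const_LY])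

lemma pts_XQY: "F \<in> pts (calL X QY) \<longleftrightarrow> F \<in> measurable X (pms_borel QY) \<and> F \<in> extensional (space X)"
  by (rule XQY.pts_calL_bounded[OF QY_bounded]) (use const_LY in \<open>auto simp: pts_QY\<close>)

definition curried :: "('x \<times> 'y \<Rightarrow> 'd) \<Rightarrow> 'x \<Rightarrow> 'y \<Rightarrow> 'd" where
  "curried f = (\<lambda>x\<in>space X. \<lambda>y\<in>space Y. f (x, y))"

lemma curried_pts_LY:
  assumes f: "f \<in> measurable (X \<Otimes>\<^sub>M Y) (count_space D)" and x: "x \<in> space X"
  shows "curried f x \<in> pts LY"
proof -
  have "(\<lambda>y. f (x, y)) \<in> measurable Y (count_space D)" using f x by measurable
  then show ?thesis using x by (simp add: curried_def LY.pts_calL_discrete measurable_restrict_iff)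
qed

text \<open>Countability of the range makes the sections range over a separable set of maps, which is what Borel
  measurability into the large space \<open>LY\<close> rests on.\<close>
lemma curried_pts:
  assumes f: "f \<in> measurable (X \<Otimes>\<^sub>M Y) (count_space D)" and C: "countable (f ` space (X \<Otimes>\<^sub>M Y))"
  shows "curried f \<in> pts (calL X LY)"
proof -
  have "f ` space (X \<Otimes>\<^sub>M Y) \<subseteq> D" using measurable_space[OF f] by auto
  then obtain S where S: "countable S" "S \<subseteq> measurable Y (count_space D)"
    "\<And>x \<epsilon>. x \<in> space X \<Longrightarrow> 0 < \<epsilon> \<Longrightarrow> \<exists>s\<in>S. measure Y {y \<in> space Y. f (x, y) \<noteq> s y} < \<epsilon>"
    using Y.separable_curried_map[OF f e C] by blast
  have neq: "{p \<in> space (X \<Otimes>\<^sub>M Y). f p \<noteq> s (snd p)} \<in> sets (X \<Otimes>\<^sub>M Y)" if "s \<in> S" for s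
  proof -
    have "s \<in> measurable Y (count_space D)" using that S(2) by blast
    then have "(\<lambda>p. s (snd p)) \<in> measurable (X \<Otimes>\<^sub>M Y) (count_space D)" by measurable
    then have "{p \<in> space (X \<Otimes>\<^sub>M Y). s (snd p) \<noteq> f p} \<in> sets (X \<Otimes>\<^sub>M Y)"
      using f C by (rule sets_neq_countable_range)
    then show ?thesis by (simp add: eq_commute)
  qed
  have dist: "pdist LY (curried f x) (restrict s (space Y)) = measure Y (Pair x -` {p \<in> space (X \<Otimes>\<^sub>M Y). f p \<noteq> s (snd p)})"
    and sect: "{y \<in> space Y. f (x, y) \<noteq> s y} = Pair x -` {p \<in> space (X \<Otimes>\<^sub>M Y). f p \<noteq> s (snd p)}"
    if "s \<in> S" "x \<in> space X" for s x
  proof -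
    show sect: "{y \<in> space Y. f (x, y) \<noteq> s y} = Pair x -` {p \<in> space (X \<Otimes>\<^sub>M Y). f p \<noteq> s (snd p)}"
      using that(2) by (auto simp: space_pair_measure)
    have "{y \<in> space Y. curried f x y \<noteq> restrict s (space Y) y} = Pair x -` {p \<in> space (X \<Otimes>\<^sub>M Y). f p \<noteq> s (snd p)}"
      unfolding sect[symmetric] using that(2) by (auto simp: curried_def)
    then show "pdist LY (curried f x) (restrict s (space Y)) = measure Y (Pair x -` {p \<in> space (X \<Otimes>\<^sub>M Y). f p \<noteq> s (snd p)})"
      using sets_Pair1[OF neq[OF that(1)]] by (simp add: LY.pdist_calL_discrete)
  qed
  have "curried f \<in> measurable X (pms_borel LY)"
  proof (rule XLY.borel_measurable_into_separable)
    show "curried f x \<in> pts LY" if "x \<in> space X" for x using curried_pts_LY[OF f that] .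
    show "countable ((\<lambda>s. restrict s (space Y)) ` S)" using S(1) by simp
    show "(\<lambda>s. restrict s (space Y)) ` S \<subseteq> pts LY"
      using S(2) by (auto simp: LY.pts_calL_discrete measurable_restrict_iff)
    show "\<exists>s\<in>(\<lambda>s. restrict s (space Y)) ` S. pdist LY (curried f x) s < \<epsilon>"
      if "x \<in> space X" "0 < \<epsilon>" for x \<epsilon>
      using S(3)[OF that] dist sect that(1) by force
    fix s' assume "s' \<in> (\<lambda>s. restrict s (space Y)) ` S"
    then obtain s where s: "s \<in> S" "s' = restrict s (space Y)" by blast
    have "(\<lambda>x. measure Y (Pair x -` {p \<in> space (X \<Otimes>\<^sub>M Y). f p \<noteq> s (snd p)})) \<in> borel_measurable X"
      unfolding measure_def using Y.measurable_emeasure_Pair[OF neq[OF s(1)]] by measurable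
    then show "(\<lambda>x. pdist LY (curried f x) s') \<in> borel_measurable X"
      unfolding s(2) by (subst measurable_cong[OF dist[OF s(1)]])
  qed
  then show ?thesis by (simp add: pts_XLY curried_def)
qed

text \<open>Currying is applied to a version of \<open>f\<close> with countable range, since measurability of
  \<open>x \<mapsto> f (x, \<cdot>)\<close> at every \<open>x\<close> is only established for such maps. On classes the choice is invisible.\<close>
definition countable_rep :: "('x \<times> 'y \<Rightarrow> 'd) \<Rightarrow> 'x \<times> 'y \<Rightarrow> 'd" where
  "countable_rep f = (SOME f'. f' \<in> pts LXY \<and> countable (f' ` space (X \<Otimes>\<^sub>M Y)) \<and> (AE p in X \<Otimes>\<^sub>M Y. f' p = f p))"

lemma countable_rep:
  assumes "f \<in> pts LXY"
  shows "countable_rep f \<in> pts LXY" "countable (countable_rep f ` space (X \<Otimes>\<^sub>M Y))" "AE p in X \<Otimes>\<^sub>M Y. countable_rep f p = f p"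
proof -
  have "\<exists>f'. f' \<in> pts LXY \<and> countable (f' ` space (X \<Otimes>\<^sub>M Y)) \<and> (AE p in X \<Otimes>\<^sub>M Y. f' p = f p)"
    using LXY.countable_range_modification[OF assms] by blast
  from someI_ex[OF this]
  show "countable_rep f \<in> pts LXY" "countable (countable_rep f ` space (X \<Otimes>\<^sub>M Y))" "AE p in X \<Otimes>\<^sub>M Y. countable_rep f p = f p"
    by (simp_all add: countable_rep_def)
qed

lemma countable_rep_measurable: "f \<in> pts LXY \<Longrightarrow> countable_rep f \<in> measurable (X \<Otimes>\<^sub>M Y) (count_space D)"
  using countable_rep(1) by (simp add: LXY.pts_calL_discrete)

lemma countable_rep_AE_sections:
  assumes "f \<in> pts LXY"
  shows "AE x in X. AE y in Y. countable_rep f (x, y) = f (x, y)"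
  using XY.AE_pair[OF countable_rep(3)[OF assms]] by simp

definition curried_rep where "curried_rep f = curried (countable_rep f)"
definition curried_class where "curried_class f = (\<lambda>x\<in>space X. pms_class LY (curried_rep f x))"

lemma curried_rep_pts: "f \<in> pts LXY \<Longrightarrow> curried_rep f \<in> pts (calL X LY)"
  unfolding curried_rep_def by (intro curried_pts countable_rep_measurable countable_rep)

lemma curried_rep_LY: "f \<in> pts LXY \<Longrightarrow> x \<in> space X \<Longrightarrow> curried_rep f x \<in> pts LY"
  unfolding curried_rep_def by (intro curried_pts_LY countable_rep_measurable)

text \<open>Fubini's theorem for the set where two countably valued versions differ.\<close>
lemma curried_rep_isometry:
  assumes f: "f \<in> pts LXY" and g: "g \<in> pts LXY"
  shows "XLY.int_dist (curried_rep f) (curried_rep g) = LXY.int_dist f g"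
proof -
  define A where "A = {p \<in> space (X \<Otimes>\<^sub>M Y). countable_rep f p \<noteq> countable_rep g p}"
  have A: "A \<in> sets (X \<Otimes>\<^sub>M Y)"
    unfolding A_def using f g by (intro sets_neq_countable_range[where D = D] countable_rep_measurable countable_rep)
  have "XLY.int_dist (curried_rep f) (curried_rep g) = (\<integral>\<^sup>+ x. emeasure Y (Pair x -` A) \<partial>X)"
    unfolding XLY.int_dist_def
  proof (rule nn_integral_cong)
    fix x assume x: "x \<in> space X"
    have "{y \<in> space Y. curried_rep f x y \<noteq> curried_rep g x y} = Pair x -` A"
      using x by (auto simp: curried_rep_def curried_def A_def space_pair_measure)
    then have "LY.int_dist (curried_rep f x) (curried_rep g x) = emeasure Y (Pair x -` A)"
      using LY.int_dist_discrete[of "curried_rep f x" "curried_rep g x"] sets_Pair1[OF A] by simp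
    then show "ennreal (pdist LY (curried_rep f x) (curried_rep g x)) = emeasure Y (Pair x -` A)"
      using LY.ennreal_pdist_calL[OF curried_rep_LY[OF f x] curried_rep_LY[OF g x]] by simp
  qed
  also have "\<dots> = emeasure (X \<Otimes>\<^sub>M Y) A"
    using A by (rule Y.emeasure_pair_measure_alt[symmetric])
  also have "\<dots> = LXY.int_dist (countable_rep f) (countable_rep g)"
    using LXY.int_dist_discrete A unfolding A_def by simp
  also have "\<dots> = LXY.int_dist f g"
    unfolding LXY.int_dist_def
  proof (rule nn_integral_cong_AE)
    show "AE p in X \<Otimes>\<^sub>M Y. ennreal (pdist (discrete_pms D) (countable_rep f p) (countable_rep g p)) =
        ennreal (pdist (discrete_pms D) (f p) (g p))"
      using countable_rep(3)[OF f] countable_rep(3)[OF g] by eventually_elim (simp only:)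
  qed
  finally show ?thesis .
qed

lemma curried_class_pts:
  assumes "f \<in> pts LXY"
  shows "curried_class f \<in> pts (calL X QY)"
proof -
  have "(\<lambda>x. pms_class LY (curried_rep f x)) \<in> measurable X (pms_borel QY)"
    using curried_rep_pts[OF assms] XLY.measurable_pms_class unfolding metL_def
    by (auto simp: pts_XLY intro: measurable_compose)
  then show ?thesis by (simp add: curried_class_def pts_XQY measurable_restrict_iff)
qed

lemma curried_class_isometry:
  assumes f: "f \<in> pts LXY" and g: "g \<in> pts LXY"
  shows "pdist (calL X QY) (curried_class f) (curried_class g) = pdist LXY f g"
proof -
  have "XQY.int_dist (curried_class f) (curried_class g) = XLY.int_dist (curried_rep f) (curried_rep g)"
    unfolding XQY.int_dist_def XLY.int_dist_def using f g
    by (intro nn_integral_cong) (simp add: curried_class_def pdist_QY curried_rep_LY)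
  then show ?thesis using curried_rep_isometry[OF f g] by (simp add: XQY.pdist_calL LXY.pdist_calL)
qed

end

section \<open>Surjectivity and equivariance\<close>

text \<open>Completeness of the space of maps into a discrete space: by the Borel-Cantelli lemma a sequence with
  geometrically small consecutive distances is almost everywhere eventually constant, and from
  index \<open>k\<close> on it changes at most on a set of measure \<open>c ((1/2)^k + (1/2)^(k+1) + \<dots>)\<close>.\<close>
lemma (in finite_measure) eventually_constant_limit:
  fixes h :: "nat \<Rightarrow> 'a \<Rightarrow> 'd" and f :: "'a \<Rightarrow> 'd"
  assumes h: "\<And>k. {y \<in> space M. h k y \<noteq> h (Suc k) y} \<in> sets M"
    and small: "\<And>k. measure M {y \<in> space M. h k y \<noteq> h (Suc k) y} \<le> c * (1/2)^k"
    and lim: "\<And>y d. y \<in> space M \<Longrightarrow> \<forall>\<^sub>F k in sequentially. h k y = d \<Longrightarrow> f y = d"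
    and f: "{y \<in> space M. f y \<noteq> h k y} \<in> sets M"
  shows "measure M {y \<in> space M. f y \<noteq> h k y} \<le> 2 * c * (1/2)^k"
proof -
  define A where "A = (\<lambda>k. {y \<in> space M. h k y \<noteq> h (Suc k) y})"
  have A: "A k \<in> sets M" for k unfolding A_def by (rule h)
  have geo: "(\<lambda>n. c * (1/2)^(n + k)) sums (2 * c * (1/2)^k)" for k
    using sums_mult[OF geometric_sums[of "1/2::real"], of "c * (1/2)^k"]
    by (simp add: power_add mult_ac)
  have summable: "summable (\<lambda>n. measure M (A (n + k)))" for k
    by (rule summable_comparison_test'[OF sums_summable[OF geo[of k]], of 0])
       (use small in \<open>simp add: A_def\<close>)
  have "AE y in M. \<forall>\<^sub>F n in sequentially. y \<in> space M - A n"
    using A summable[of 0] by (intro borel_cantelli_AE1) (auto simp: less_top[symmetric])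
  then have "AE y in M. y \<in> {y \<in> space M. f y \<noteq> h k y} \<longrightarrow> y \<in> (\<Union>n. A (n + k))"
    using AE_space
  proof eventually_elim
    case (elim y)
    show ?case
    proof (intro impI, rule ccontr)
      assume y: "y \<in> {y \<in> space M. f y \<noteq> h k y}" "y \<notin> (\<Union>n. A (n + k))"
      have const: "h (n + k) y = h k y" for n
        by (induction n) (use y elim(2) in \<open>auto simp: A_def\<close>)
      have "\<forall>\<^sub>F n in sequentially. h n y = h k y"
        using eventually_ge_at_top[of k]
      proof eventually_elim
        case (elim n)
        then show ?case using const[of "n - k"] by simp
      qed
      then have "f y = h k y" by (rule lim[OF elim(2)])
      then show False using y by simp
    qed
  qed
  then have "measure M {y \<in> space M. f y \<noteq> h k y} \<le> measure M (\<Union>n. A (n + k))"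
    using A by (intro finite_measure_mono_AE) auto
  also have "\<dots> \<le> (\<Sum>n. measure M (A (n + k)))"
    using A summable[of k] by (intro finite_measure_subadditive_countably) auto
  also have "\<dots> \<le> (\<Sum>n. c * (1/2)^(n + k))"
    using small by (intro suminf_le summable sums_summable[OF geo]) (simp add: A_def)
  also have "\<dots> = 2 * c * (1/2)^k" using geo by (rule sums_unique[symmetric])
  finally show ?thesis .
qed

context two_factors
begin

text \<open>Stated with one countable set \<open>C\<close> of values for all \<open>k\<close>, for then \<open>f\<close> takes its values in
  \<open>insert e C\<close> and only its fibres have to be measurable.\<close>
lemma eventual_value_measurable:
  fixes F :: "nat \<Rightarrow> 'x \<times> 'y \<Rightarrow> 'd"
  assumes F: "\<And>k. F k \<in> measurable (X \<Otimes>\<^sub>M Y) (count_space D)"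
    and C: "countable C" "C \<subseteq> D" "\<And>k p. p \<in> space (X \<Otimes>\<^sub>M Y) \<Longrightarrow> F k p \<in> C"
  obtains f where "f \<in> measurable (X \<Otimes>\<^sub>M Y) (count_space D)" "countable (f ` space (X \<Otimes>\<^sub>M Y))"
    "\<forall>p\<in>space (X \<Otimes>\<^sub>M Y). \<forall>c. (\<forall>\<^sub>F k in sequentially. F k p = c) \<longrightarrow> f p = c"
proof -
  let ?S = "space (X \<Otimes>\<^sub>M Y)"
  define Ev where "Ev = (\<lambda>c. {p \<in> ?S. \<forall>\<^sub>F k in sequentially. F k p = c})"
  define f where "f = (\<lambda>p. if \<exists>c. p \<in> Ev c then (THE c. p \<in> Ev c) else e)"
  have uniq: "c = c'" if p: "p \<in> Ev c" "p \<in> Ev c'" for p c c'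
  proof -
    have "\<forall>\<^sub>F k in sequentially. F k p = c" "\<forall>\<^sub>F k in sequentially. F k p = c'"
      using p by (simp_all add: Ev_def)
    then have "\<forall>\<^sub>F k::nat in sequentially. c = c'" by eventually_elim simp
    then show ?thesis by simp
  qed
  have f_eq: "f p = c" if "p \<in> Ev c" for p c
  proof -
    have "(THE c. p \<in> Ev c) = c" using that uniq[OF _ that] by (rule the_equality)
    then show ?thesis using that by (auto simp: f_def)
  qed
  have Ev_C: "c \<in> C" if p: "p \<in> Ev c" for p c
  proof -
    obtain k where "F k p = c" using p eventually_happens' sequentially_bot unfolding Ev_def by blast
    then show ?thesis using C(3)[of p k] p by (simp add: Ev_def)
  qed
  have Ev: "Ev c \<in> sets (X \<Otimes>\<^sub>M Y)" if "c \<in> C" for c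
  proof -
    have "Ev c = (\<Union>m. \<Inter>k\<in>{m..}. F k -` {c} \<inter> ?S)"
      by (auto simp: Ev_def eventually_sequentially)
    also have "\<dots> \<in> sets (X \<Otimes>\<^sub>M Y)"
      using that C(2) F by (intro sets.countable_UN sets.countable_INT' image_subsetI measurable_sets) auto
    finally show ?thesis .
  qed
  have range: "f p \<in> insert e C" for p
  proof (cases "\<exists>c. p \<in> Ev c")
    case True
    then obtain c where "p \<in> Ev c" by blast
    then show ?thesis using f_eq Ev_C by auto
  qed (simp add: f_def)
  have none: "f p = e" if "\<not> (\<exists>c\<in>C. p \<in> Ev c)" for p
  proof -
    have "\<not> (\<exists>c. p \<in> Ev c)" using that Ev_C by blast
    then show ?thesis by (simp add: f_def)
  qed
  show ?thesis
  proof (rule that)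
    have UEv: "?S - (\<Union>c\<in>C. Ev c) \<in> sets (X \<Otimes>\<^sub>M Y)"
      using Ev C(1) by (intro sets.Diff sets.top sets.countable_UN' image_subsetI) auto
    show "f \<in> measurable (X \<Otimes>\<^sub>M Y) (count_space D)"
    proof (rule measurable_count_space_countable_subset[of "insert e C"])
      fix c
      define E\<^sub>c where "E\<^sub>c = (if c \<in> C then Ev c else {})"
      have "f -` {c} \<inter> ?S = E\<^sub>c \<union> (if c = e then ?S - (\<Union>c\<in>C. Ev c) else {})"
      proof (intro set_eqI iffI)
        fix p assume p: "p \<in> f -` {c} \<inter> ?S"
        show "p \<in> E\<^sub>c \<union> (if c = e then ?S - (\<Union>c\<in>C. Ev c) else {})"
        proof (cases "\<exists>c\<in>C. p \<in> Ev c")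
          case True
          then obtain c' where "c' \<in> C" "p \<in> Ev c'" by blast
          then show ?thesis using f_eq p by (auto simp: E\<^sub>c_def)
        next
          case False
          then show ?thesis using none p by auto
        qed
      next
        fix p assume "p \<in> E\<^sub>c \<union> (if c = e then ?S - (\<Union>c\<in>C. Ev c) else {})"
        then show "p \<in> f -` {c} \<inter> ?S"
          using f_eq[of p c] none[of p] by (auto simp: E\<^sub>c_def Ev_def split: if_splits)
      qed
      then show "f -` {c} \<inter> ?S \<in> sets (X \<Otimes>\<^sub>M Y)" using Ev UEv by (simp add: E\<^sub>c_def)
    qed (use C e range in auto)
    show "countable (f ` ?S)"
      using range C(1) by (intro countable_subset[of "f ` ?S" "insert e C"]) auto
    show "\<forall>p\<in>?S. \<forall>c. (\<forall>\<^sub>F k in sequentially. F k p = c) \<longrightarrow> f p = c"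
      using f_eq by (simp add: Ev_def)
  qed
qed

lemma class_eq_curried_AE:
  assumes f: "f \<in> pts LXY"
  shows "AE x in X. pms_class LY (curried f x) = pms_class LY (curried_rep f x)"
  using countable_rep_AE_sections[OF f] AE_space
proof eventually_elim
  case (elim x)
  have fm: "f \<in> measurable (X \<Otimes>\<^sub>M Y) (count_space D)" using f by (simp add: LXY.pts_calL_discrete)
  have "AE y in Y. curried f x y = curried_rep f x y"
    using elim(1) AE_space by eventually_elim (simp add: curried_rep_def curried_def elim(2))
  then show ?case
    using curried_rep_LY[OF f elim(2)] curried_pts_LY[OF fm elim(2)]
    by (simp add: XLY.pms_class_eq_iff LY.pdist_calL_discrete_eq_0_iff)
qed

text \<open>The limit is taken on each fibre \<open>{x} \<times> Y\<close> separately, but the eventual values form one measurable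
  map on the product.\<close>
lemma curried_class_onto:
  assumes G: "G \<in> pts (calL X QY)"
  shows "\<exists>f\<in>pts LXY. pdist (calL X QY) (curried_class f) G = 0"
proof -
  have Gm: "G \<in> measurable X (pms_borel QY)" using G by (simp add: pts_XQY)
  have GQ: "G x \<in> pts QY" if "x \<in> space X" for x using measurable_space[OF Gm that] by simp
  obtain S where S: "countable S" "S \<subseteq> pts QY" "AE x in X. \<forall>\<epsilon>>0. \<exists>s\<in>S. pdist QY (G x) s < \<epsilon>"
    using Gm by (rule XQY.ae_separable_range)
  \<comment> \<open>A constant class is added to \<open>S\<close> so that the enumeration is meaningful even for empty \<open>S\<close>.\<close>
  define s where "s = from_nat_into (insert (pms_class LY (\<lambda>y\<in>space Y. e)) S)"
  have sQ: "s n \<in> pts QY" for n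
    using from_nat_into[of "insert (pms_class LY (\<lambda>y\<in>space Y. e)) S" n] S(2) const_LY
    by (auto simp: s_def pts_QY)
  have s_surj: "\<exists>n. s n = c" if "c \<in> S" for c
    unfolding s_def using S(1) that by (intro from_nat_into_surj) auto
  have "\<exists>g. \<forall>n. g n \<in> pts LY \<and> countable (g n ` space Y) \<and> pms_class LY (g n) = s n"
  proof (intro choice allI)
    fix n
    obtain h where h: "h \<in> pts LY" "s n = pms_class LY h" using sQ[of n] by (auto simp: pts_QY)
    obtain g where "g \<in> pts LY" "countable (g ` space Y)" "AE y in Y. g y = h y"
      using h(1) by (rule LY.countable_range_modification)
    then show "\<exists>g. g \<in> pts LY \<and> countable (g ` space Y) \<and> pms_class LY g = s n"
      using h by (intro exI[of _ g])
        (simp add: XLY.pms_class_eq_iff LY.pdist_calL_discrete_eq_0_iff)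
  qed
  then obtain g where "\<forall>n. g n \<in> pts LY \<and> countable (g n ` space Y) \<and> pms_class LY (g n) = s n" ..
  then have g: "\<And>n. g n \<in> pts LY" "\<And>n. countable (g n ` space Y)" "\<And>n. pms_class LY (g n) = s n"
    by simp_all
  have gm: "g n \<in> measurable Y (count_space D)" for n using g(1) by (simp add: LY.pts_calL_discrete)
  \<comment> \<open>Where no index qualifies, which happens only on a null set, \<open>N k x\<close> is an unspecified but measurable value.\<close>
  define N where "N = (\<lambda>k x. LEAST n. pdist QY (G x) (s n) < (1/2)^k)"
  have N: "N k \<in> measurable X (count_space UNIV)" for k
    unfolding N_def
  proof (rule measurable_Least)
    fix n
    have "(\<lambda>x. pdist QY (G x) (s n)) \<in> borel_measurable X"
      using Gm XQY.measurable_pdist[OF sQ] by measurable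
    then show "Measurable.pred X (\<lambda>x. pdist QY (G x) (s n) < (1/2)^k)" by measurable
  qed
  define F where "F = (\<lambda>k p. g (N k (fst p)) (snd p))"
  have F: "F k \<in> measurable (X \<Otimes>\<^sub>M Y) (count_space D)" for k
    unfolding F_def
  proof (rule measurable_compose_countable)
    show "(\<lambda>p. g n (snd p)) \<in> measurable (X \<Otimes>\<^sub>M Y) (count_space D)" for n using gm[of n] by measurable
    show "(\<lambda>p. N k (fst p)) \<in> measurable (X \<Otimes>\<^sub>M Y) (count_space UNIV)" using N[of k] by measurable
  qed
  define C where "C = (\<Union>n. g n ` space Y)"
  have C: "countable C" "C \<subseteq> D" "\<And>k p. p \<in> space (X \<Otimes>\<^sub>M Y) \<Longrightarrow> F k p \<in> C"
    using g(2) measurable_space[OF gm] unfolding C_def F_def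
    by (simp, force, fastforce simp: space_pair_measure)
  obtain f0 where f0: "f0 \<in> measurable (X \<Otimes>\<^sub>M Y) (count_space D)" "countable (f0 ` space (X \<Otimes>\<^sub>M Y))"
    and lim: "\<forall>p\<in>space (X \<Otimes>\<^sub>M Y). \<forall>c. (\<forall>\<^sub>F k in sequentially. F k p = c) \<longrightarrow> f0 p = c"
    by (rule eventual_value_measurable[of F C, OF F C])
  define f where "f = restrict f0 (space (X \<Otimes>\<^sub>M Y))"
  have f: "f \<in> pts LXY" using f0 by (simp add: f_def LXY.pts_calL_discrete measurable_restrict_iff)
  have fm: "f \<in> measurable (X \<Otimes>\<^sub>M Y) (count_space D)" using f by (simp add: LXY.pts_calL_discrete)
  have "AE x in X. pdist QY (pms_class LY (curried f x)) (G x) = 0"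
    using S(3) AE_space
  proof eventually_elim
    case (elim x)
    note x = elim(2)
    have near: "pdist QY (G x) (s (N k x)) < (1/2)^k" for k
    proof -
      obtain c where "c \<in> S" "pdist QY (G x) c < (1/2)^k" using elim(1)[rule_format, of "(1/2)^k"] by auto
      moreover obtain n where "s n = c" using s_surj[OF \<open>c \<in> S\<close>] ..
      ultimately have "\<exists>n. pdist QY (G x) (s n) < (1/2)^k" by blast
      then show ?thesis unfolding N_def by (rule LeastI_ex)
    qed
    have neq: "{y \<in> space Y. g m y \<noteq> g n y} \<in> sets Y" for m n
      using gm gm g(2) by (rule sets_neq_countable_range)
    have step: "measure Y {y \<in> space Y. g (N k x) y \<noteq> g (N (Suc k) x) y} \<le> 2 * (1/2)^k" for k
    proof -
      have "measure Y {y \<in> space Y. g (N k x) y \<noteq> g (N (Suc k) x) y} = pdist LY (g (N k x)) (g (N (Suc k) x))"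
        using neq by (simp add: LY.pdist_calL_discrete)
      also have "\<dots> = pdist QY (s (N k x)) (s (N (Suc k) x))"
        using g by (simp add: pdist_QY[symmetric])
      also have "\<dots> \<le> pdist QY (G x) (s (N k x)) + pdist QY (G x) (s (N (Suc k) x))"
        using XQY.d_tri[OF sQ GQ[OF x] sQ, of "N k x" "N (Suc k) x"] XQY.d_sym[OF sQ GQ[OF x]] by simp
      also have "\<dots> \<le> (1/2)^k + (1/2)^Suc k" using near[of k] near[of "Suc k"] by linarith
      also have "\<dots> \<le> 2 * (1/2)^k" by simp
      finally show ?thesis .
    qed
    have cx: "curried f x \<in> pts LY" using fm x by (rule curried_pts_LY)
    have cm: "curried f x \<in> measurable Y (count_space D)" using cx by (simp add: LY.pts_calL_discrete)
    have neq': "{y \<in> space Y. curried f x y \<noteq> g n y} \<in> sets Y" for n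
      using cm gm g(2) by (rule sets_neq_countable_range)
    have bound: "pdist QY (pms_class LY (curried f x)) (G x) \<le> 5 * (1/2)^k" for k
    proof -
      have "measure Y {y \<in> space Y. curried f x y \<noteq> g (N k x) y} \<le> 2 * 2 * (1/2)^k"
      proof (rule Y.eventually_constant_limit[where h = "\<lambda>k. g (N k x)"])
        fix y d assume y: "y \<in> space Y" "\<forall>\<^sub>F k in sequentially. g (N k x) y = d"
        then have "f0 (x, y) = d" using x by (intro lim[rule_format]) (auto simp: F_def space_pair_measure)
        then show "curried f x y = d" using x y by (simp add: curried_def f_def space_pair_measure)
      qed (use neq neq' step in auto)
      then have "pdist QY (pms_class LY (curried f x)) (s (N k x)) \<le> 4 * (1/2)^k"
        using g cx neq' by (simp add: pdist_QY g(3)[symmetric] LY.pdist_calL_discrete)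
      moreover have "pms_class LY (curried f x) \<in> pts QY" using cx by (simp add: pts_QY)
      ultimately show ?thesis
        using XQY.d_tri[OF _ sQ GQ[OF x], of "pms_class LY (curried f x)" "N k x"]
          XQY.d_sym[OF sQ GQ[OF x], of "N k x"] near[of k] by simp
    qed
    have "(\<lambda>k. 5 * (1/2::real)^k) \<longlonglongrightarrow> 5 * 0"
      by (intro tendsto_mult tendsto_const LIMSEQ_realpow_zero) auto
    then have "pdist QY (pms_class LY (curried f x)) (G x) \<le> 5 * 0"
      by (rule LIMSEQ_le_const) (use bound in blast)
    moreover have "0 \<le> pdist QY (pms_class LY (curried f x)) (G x)"
      using cx GQ[OF x] by (intro XQY.d_nonneg) (auto simp: pts_QY)
    ultimately show ?case by simp
  qed
  then have "AE x in X. pdist QY (curried_class f x) (G x) = 0"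
    using class_eq_curried_AE[OF f] AE_space by eventually_elim (simp add: curried_class_def)
  then show ?thesis using XQY.pdist_calL_eq_0_iff[OF curried_class_pts[OF f] G] f by blast
qed

text \<open>Both sides are represented by maps that agree almost everywhere: permuting values commutes
  with currying, and the countably valued versions differ from the given maps on null sets only,
  which meet almost every fibre in a null set.\<close>
lemma curried_class_equivariant:
  assumes \<sigma>: "\<sigma> permutes D" and f: "f \<in> pts LXY"
  shows "pms_class (calL X QY) (curried_class (\<lambda>p\<in>space (X \<Otimes>\<^sub>M Y). \<sigma> (f p))) =
    metL_act X QY (metL_act Y (discrete_pms D) \<sigma>) (pms_class (calL X QY) (curried_class f))"
proof -
  interpret XQ: pseudo_metric "calL X QY" by unfold_locales (rule XQY.pseudo_metric_space_calL)
  define \<sigma>f where "\<sigma>f = (\<lambda>p\<in>space (X \<Otimes>\<^sub>M Y). \<sigma> (f p))"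
  let ?T = "metL_act Y (discrete_pms D) \<sigma>"
  have \<sigma>D: "\<sigma> \<in> pts (discrete_pms D) \<rightarrow> pts (discrete_pms D)"
    using permutes_in_image[OF \<sigma>] by auto
  have \<sigma>iso: "\<forall>x\<in>pts (discrete_pms D). \<forall>y\<in>pts (discrete_pms D).
      pdist (discrete_pms D) (\<sigma> x) (\<sigma> y) = pdist (discrete_pms D) x y"
    using permutes_inj[OF \<sigma>] by (auto simp: inj_eq)
  have \<sigma>f: "\<sigma>f \<in> pts LXY" unfolding \<sigma>f_def using \<sigma>D \<sigma>iso f by (rule LXY.postcompose_pts)
  have T: "?T \<in> pts QY \<rightarrow> pts QY" "\<forall>C\<in>pts QY. \<forall>C'\<in>pts QY. pdist QY (?T C) (?T C') = pdist QY C C'"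
    using LY.metL_act_isometry[OF \<sigma>D \<sigma>iso] by auto
  have act: "metL_act X QY ?T (pms_class (calL X QY) (curried_class f)) =
      pms_class (calL X QY) (\<lambda>x\<in>space X. ?T (curried_class f x))"
    using T curried_class_pts[OF f] by (rule XQY.metL_act_class)
  have pts: "(\<lambda>x\<in>space X. ?T (curried_class f x)) \<in> pts (calL X QY)"
    using T curried_class_pts[OF f] by (rule XQY.postcompose_pts)
  have "AE x in X. curried_class \<sigma>f x = (\<lambda>x\<in>space X. ?T (curried_class f x)) x"
    using countable_rep_AE_sections[OF f] countable_rep_AE_sections[OF \<sigma>f] AE_space
  proof eventually_elim
    case (elim x)
    note x = elim(3)
    have "AE y in Y. curried_rep \<sigma>f x y = (\<lambda>y\<in>space Y. \<sigma> (curried_rep f x y)) y"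
      using elim(1,2) AE_space
      by eventually_elim (simp add: curried_rep_def curried_def \<sigma>f_def x space_pair_measure)
    then have "pms_class LY (curried_rep \<sigma>f x) = pms_class LY (\<lambda>y\<in>space Y. \<sigma> (curried_rep f x y))"
      using curried_rep_LY[OF \<sigma>f x] LY.postcompose_pts[OF \<sigma>D \<sigma>iso curried_rep_LY[OF f x]]
      by (simp add: XLY.pms_class_eq_iff LY.pdist_calL_discrete_eq_0_iff)
    then show ?case
      using x LY.metL_act_class[OF \<sigma>D \<sigma>iso curried_rep_LY[OF f x]] by (simp add: curried_class_def)
  qed
  then have "pdist (calL X QY) (curried_class \<sigma>f) (\<lambda>x\<in>space X. ?T (curried_class f x)) = 0"
    unfolding XQY.pdist_calL_eq_0_iff[OF curried_class_pts[OF \<sigma>f] pts]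
    using AE_space
  proof eventually_elim
    case (elim x)
    then show ?case
      using measurable_space[of "\<lambda>x\<in>space X. ?T (curried_class f x)" X "pms_borel QY" x] pts XQY.d_refl
      by (simp add: pts_XQY)
  qed
  then show ?thesis
    using XQ.pms_class_eq_iff[OF curried_class_pts[OF \<sigma>f] pts] act unfolding \<sigma>f_def by simp
qed

lemma curry_isometry:
  "\<exists>\<Phi> \<Psi>.
      pms_morphism LXY (calL X LY) \<Phi> \<and>
      (\<forall>f\<in>pts LXY. \<Psi> (pms_class LXY f) =
         pms_class (calL X QY) (\<lambda>x\<in>space X. pms_class LY (\<Phi> f x))) \<and>
      bijective_isometry (metL (X \<Otimes>\<^sub>M Y) (discrete_pms D)) (metL X QY) \<Psi> \<and>
      (\<forall>\<sigma>. \<sigma> permutes D \<longrightarrow>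
         (\<forall>F\<in>pts (metL (X \<Otimes>\<^sub>M Y) (discrete_pms D)).
            \<Psi> (metL_act (X \<Otimes>\<^sub>M Y) (discrete_pms D) \<sigma> F) =
            metL_act X QY (metL_act Y (discrete_pms D) \<sigma>) (\<Psi> F)))"
proof -
  obtain \<Psi> where \<Psi>: "bijective_isometry (metric_quotient LXY) (metric_quotient (calL X QY)) \<Psi>"
    "\<forall>f\<in>pts LXY. \<Psi> (pms_class LXY f) = pms_class (calL X QY) (curried_class f)"
    using induced_bijective_isometry[OF LXY.pseudo_metric_space_calL
        XQY.pseudo_metric_space_calL curried_class_pts curried_class_isometry curried_class_onto] by blast
  interpret L: pseudo_metric LXY by unfold_locales (rule LXY.pseudo_metric_space_calL)
  have morph: "pms_morphism LXY (calL X LY) curried_rep"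
    unfolding pms_morphism_def
    using LXY.pseudo_metric_space_calL XLY.pseudo_metric_space_calL curried_rep_pts curried_rep_isometry
    by (auto simp: LXY.pdist_calL XLY.pdist_calL)
  have equi: "\<Psi> (metL_act (X \<Otimes>\<^sub>M Y) (discrete_pms D) \<sigma> F) =
      metL_act X QY (metL_act Y (discrete_pms D) \<sigma>) (\<Psi> F)"
    if \<sigma>: "\<sigma> permutes D" and F: "F \<in> pts (metL (X \<Otimes>\<^sub>M Y) (discrete_pms D))" for \<sigma> F
  proof -
    obtain f where f: "f \<in> pts LXY" "F = pms_class LXY f"
      using F by (auto simp: metL_def L.pts_quotient)
    have \<sigma>D: "\<sigma> \<in> pts (discrete_pms D) \<rightarrow> pts (discrete_pms D)"
      using permutes_in_image[OF \<sigma>] by auto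
    have \<sigma>iso: "\<forall>x\<in>pts (discrete_pms D). \<forall>y\<in>pts (discrete_pms D).
        pdist (discrete_pms D) (\<sigma> x) (\<sigma> y) = pdist (discrete_pms D) x y"
      using permutes_inj[OF \<sigma>] by (auto simp: inj_eq)
    have "\<Psi> (metL_act (X \<Otimes>\<^sub>M Y) (discrete_pms D) \<sigma> F) =
        \<Psi> (pms_class LXY (\<lambda>p\<in>space (X \<Otimes>\<^sub>M Y). \<sigma> (f p)))"
      using LXY.metL_act_class[OF \<sigma>D \<sigma>iso f(1)] f(2) by simp
    also have "\<dots> = pms_class (calL X QY) (curried_class (\<lambda>p\<in>space (X \<Otimes>\<^sub>M Y). \<sigma> (f p)))"
      using LXY.postcompose_pts[OF \<sigma>D \<sigma>iso f(1)] by (rule \<Psi>(2)[rule_format])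
    also have "\<dots> = metL_act X QY (metL_act Y (discrete_pms D) \<sigma>) (\<Psi> F)"
      using curried_class_equivariant[OF \<sigma> f(1)] \<Psi>(2)[rule_format, OF f(1)] f(2) by simp
    finally show ?thesis .
  qed
  have "\<forall>f\<in>pts LXY. \<Psi> (pms_class LXY f) =
      pms_class (calL X QY) (\<lambda>x\<in>space X. pms_class LY (curried_rep f x))"
    using \<Psi>(2) by (simp add: curried_class_def)
  moreover have "bijective_isometry (metL (X \<Otimes>\<^sub>M Y) (discrete_pms D)) (metL X QY) \<Psi>"
    using \<Psi>(1) by (simp add: metL_def)
  ultimately show ?thesis using morph equi by blast
qed

end

theorem theorem8p3:
  fixes X :: "'x measure" and Y :: "'y measure" and D :: "'d set" and e :: 'd
  assumes "nonatomic_standard_prob_space X"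
    and "nonatomic_standard_prob_space Y"
    and "e \<in> D"
  shows "\<exists>\<Phi> \<Psi>.
      pms_morphism (calL (X \<Otimes>\<^sub>M Y) (discrete_pms D)) (calL X (calL Y (discrete_pms D))) \<Phi> \<and>
      (\<forall>f\<in>pts (calL (X \<Otimes>\<^sub>M Y) (discrete_pms D)).
         \<Psi> (pms_class (calL (X \<Otimes>\<^sub>M Y) (discrete_pms D)) f) =
         pms_class (calL X (metL Y (discrete_pms D)))
           (\<lambda>x\<in>space X. pms_class (calL Y (discrete_pms D)) (\<Phi> f x))) \<and>
      bijective_isometry (metL (X \<Otimes>\<^sub>M Y) (discrete_pms D)) (metL X (metL Y (discrete_pms D))) \<Psi> \<and>
      (\<forall>\<sigma>. \<sigma> permutes D \<longrightarrow>
         (\<forall>F\<in>pts (metL (X \<Otimes>\<^sub>M Y) (discrete_pms D)).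
            \<Psi> (metL_act (X \<Otimes>\<^sub>M Y) (discrete_pms D) \<sigma> F) =
            metL_act X (metL Y (discrete_pms D)) (metL_act Y (discrete_pms D) \<sigma>) (\<Psi> F)))"
proof -
  have X: "prob_space X" "standard_borel_space X" and Y: "prob_space Y" "standard_borel_space Y"
    using assms by (auto simp: nonatomic_standard_prob_space_def)
  obtain i :: "'x \<Rightarrow> nat \<Rightarrow> real" where i: "borel_embedding X i"
    using X(2) by (rule standard_borel_space_embedding)
  obtain j :: "'y \<Rightarrow> nat \<Rightarrow> real" where j: "borel_embedding Y j"
    using Y(2) by (rule standard_borel_space_embedding)
  interpret two_factors X i Y j D e
    by (intro two_factors.intro embedded_prob_space.intro embedded_prob_space_axioms.intro
        two_factors_axioms.intro X Y i j assms)
  show ?thesis by (rule curry_isometry)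
qed

end
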